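(* The following decision problem is undecidable. Input: a Mealy automaton $\mathcal{M}=(Q,\Sigma,\cdot,\circ)$ and a proper subset $Q'\subsetneq Q$. Question: does $\mathcal{M}$ have a commuting pair restricted to the stateset $Q'$, that is, do there exist nonempty words $u\in Q'^{*}$ and $v\in\Sigma^{*}$ with $u\cdot v=u$ and $u\circ v=v$?
   Context: A Mealy automaton is $\mathcal{M}=(Q,\Sigma,\cdot,\circ)$ with finite nonempty sets $Q$ (states) and $\Sigma$ (alphabet), a transition function $(q,a)\mapsto q\cdot a\in Q$ and a production function $(q,a)\mapsto q\circ a\in\Sigma$. They extend to words: for $q\in Q$, $q\circ(a_1\cdots a_n)=(q\circ a_1)\big((q\cdot a_1)\circ(a_2\cdots a_n)\big)$ and $q\cdot(a_1\cdots a_n)=(\cdots(q\cdot a_1)\cdots)\cdot a_n$; and for words of states $h,g\in Q^*$, $v\in\Sigma^*$: $(hg)\circ v=h\circ(g\circ v)$ and $(hg)\cdot v=\big(h\cdot(g\circ v)\big)(g\cdot v)$. Thus $u\circ v\in\Sigma^{|v|}$ and $u\cdot v\in Q^{|u|}$. *)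

theory Defs
  imports Main "HOL-Library.Nat_Bijection"
begin

section \<open>Mealy automata\<close>

record ('q, 'a) mealy =
  states :: "'q set"
  alphabet :: "'a set"
  transition :: "'q \<Rightarrow> 'a \<Rightarrow> 'q"
  production :: "'q \<Rightarrow> 'a \<Rightarrow> 'a"

definition mealy_automaton :: "('q, 'a) mealy \<Rightarrow> bool" where
  "mealy_automaton M \<longleftrightarrow>
     finite (states M) \<and> states M \<noteq> {} \<and> finite (alphabet M) \<and> alphabet M \<noteq> {} \<and>
     (\<forall>q \<in> states M. \<forall>a \<in> alphabet M.
        transition M q a \<in> states M \<and> production M q a \<in> alphabet M)"

primrec state_trans :: "('q, 'a) mealy \<Rightarrow> 'q \<Rightarrow> 'a list \<Rightarrow> 'q" where
  "state_trans M q [] = q"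
| "state_trans M q (a # v) = state_trans M (transition M q a) v"

primrec state_output :: "('q, 'a) mealy \<Rightarrow> 'q \<Rightarrow> 'a list \<Rightarrow> 'a list" where
  "state_output M q [] = []"
| "state_output M q (a # v) = production M q a # state_output M (transition M q a) v"

text \<open>
  Words of states act on the left: the last letter of the list is applied first, so that
  \<open>(hg) \<circ> v = h \<circ> (g \<circ> v)\<close> and \<open>(hg) \<cdot> v = (h \<cdot> (g \<circ> v)) (g \<cdot> v)\<close>; see the append lemmas below.
\<close>

primrec word_output :: "('q, 'a) mealy \<Rightarrow> 'q list \<Rightarrow> 'a list \<Rightarrow> 'a list" where
  "word_output M [] v = v"
| "word_output M (q # u) v = state_output M q (word_output M u v)"

primrec word_trans :: "('q, 'a) mealy \<Rightarrow> 'q list \<Rightarrow> 'a list \<Rightarrow> 'q list" where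
  "word_trans M [] v = []"
| "word_trans M (q # u) v = state_trans M q (word_output M u v) # word_trans M u v"

lemma word_output_append:
  "word_output M (h @ g) v = word_output M h (word_output M g v)"
  by (induction h) auto

lemma word_trans_append:
  "word_trans M (h @ g) v = word_trans M h (word_output M g v) @ word_trans M g v"
  by (induction h) (auto simp: word_output_append)

definition has_commuting_pair_on :: "('q, 'a) mealy \<Rightarrow> 'q set \<Rightarrow> bool" where
  "has_commuting_pair_on M Q' \<longleftrightarrow>
     (\<exists>u v. u \<noteq> [] \<and> v \<noteq> [] \<and> u \<in> lists Q' \<and> v \<in> lists (alphabet M) \<and>
            word_trans M u v = u \<and> word_output M u v = v)"


section \<open>Partial recursive functions and decidability\<close>

text \<open>
  Kleene's mu-recursive functions. Terms carry no arity: a term denotes a partial function of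
  every arity, and applying an operation to a wrong number of arguments is undefined.
  \<open>rec_eval f xs y\<close> means that \<open>f\<close> is defined on \<open>xs\<close> with value \<open>y\<close>.
\<close>

datatype recf = Zero | Succ | Proj nat | Comp recf "recf list" | PrimRec recf recf | Mu recf

inductive rec_eval :: "recf \<Rightarrow> nat list \<Rightarrow> nat \<Rightarrow> bool" where
  Zero: "rec_eval Zero xs 0"
| Succ: "rec_eval Succ [x] (Suc x)"
| Proj: "i < length xs \<Longrightarrow> rec_eval (Proj i) xs (xs ! i)"
| Comp: "list_all2 (\<lambda>g y. rec_eval g xs y) gs ys \<Longrightarrow> rec_eval f ys z \<Longrightarrow> rec_eval (Comp f gs) xs z"
| PrimRec_0: "rec_eval f xs y \<Longrightarrow> rec_eval (PrimRec f g) (0 # xs) y"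
| PrimRec_Suc: "rec_eval (PrimRec f g) (n # xs) y \<Longrightarrow> rec_eval g (n # y # xs) z \<Longrightarrow>
     rec_eval (PrimRec f g) (Suc n # xs) z"
| Mu: "rec_eval f (n # xs) 0 \<Longrightarrow> (\<forall>m < n. \<exists>y. rec_eval f (m # xs) (Suc y)) \<Longrightarrow>
     rec_eval (Mu f) xs n"

inductive_cases rec_eval_elims:
  "rec_eval Zero xs y"
  "rec_eval Succ xs y"
  "rec_eval (Proj i) xs y"
  "rec_eval (Comp f gs) xs y"
  "rec_eval (PrimRec f g) (0 # xs) y"
  "rec_eval (PrimRec f g) (Suc n # xs) y"
  "rec_eval (Mu f) xs y"

lemma rec_eval_deterministic: "rec_eval f xs y \<Longrightarrow> rec_eval f xs z \<Longrightarrow> y = z"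
proof (induction arbitrary: z rule: rec_eval.induct)
  case (Comp xs gs ys f y)
  from Comp.prems obtain ys' where
    ys': "list_all2 (\<lambda>g y. rec_eval g xs y) gs ys'" "rec_eval f ys' z"
    by (rule rec_eval_elims)
  have "ys = ys'"
    using Comp.IH(1) ys'(1) by (auto simp: list_all2_conv_all_nth intro: nth_equalityI)
  then show ?case using Comp.IH(2) ys'(2) by blast
next
  case (PrimRec_Suc f g n xs y w)
  from PrimRec_Suc.prems obtain y' where
    "rec_eval (PrimRec f g) (n # xs) y'" "rec_eval g (n # y' # xs) z"
    by (rule rec_eval_elims)
  then show ?case using PrimRec_Suc.IH by blast
next
  case (Mu f n xs)
  from Mu.prems have z: "rec_eval f (z # xs) 0" "\<forall>m < z. \<exists>y. rec_eval f (m # xs) (Suc y)"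
    by (auto elim: rec_eval_elims)
  show ?case
  proof (cases n z rule: linorder_cases)
    case less
    then show ?thesis using z(2) Mu.IH(1) by blast
  next
    case greater
    then show ?thesis using z(1) Mu.IH(2) by blast
  qed
qed (erule rec_eval_elims, simp; fail)+

text \<open>
  A decision problem consists of a set \<open>I\<close> of instances, an encoding \<open>enc\<close> of instances by natural
  numbers and the set \<open>P\<close> of positive instances. Nothing is required of the decision procedure
  on numbers that do not encode an instance; it need not even terminate there.
\<close>

definition decidable :: "'i set \<Rightarrow> ('i \<Rightarrow> nat) \<Rightarrow> ('i \<Rightarrow> bool) \<Rightarrow> bool" where
  "decidable I enc P \<longleftrightarrow> (\<exists>f. \<forall>i \<in> I. rec_eval f [enc i] (if P i then 1 else 0))"


section \<open>Instances of the problem\<close>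

text \<open>
  To be an input of an algorithm an automaton has to be presented by finite data, hence states and
  letters are named by natural numbers: \<open>states M\<close> and \<open>alphabet M\<close> are arbitrary nonempty finite
  sets of naturals. The code lists the states, the letters, the chosen states, and
  the pairs \<open>(q \<cdot> a, q \<circ> a)\<close> with \<open>(q, a)\<close> ranging in lexicographic order over
  \<open>states M \<times> alphabet M\<close>.
\<close>

definition commuting_pair_instances :: "((nat, nat) mealy \<times> nat set) set" where
  "commuting_pair_instances = {(M, Q'). mealy_automaton M \<and> Q' \<subset> states M}"

fun encode_instance :: "(nat, nat) mealy \<times> nat set \<Rightarrow> nat" where
  "encode_instance (M, Q') = list_encode
     [list_encode (sorted_list_of_set (states M)),
      list_encode (sorted_list_of_set (alphabet M)),
      list_encode (sorted_list_of_set Q'),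
      list_encode (map (\<lambda>(q, a). prod_encode (transition M q a, production M q a))
        (List.product (sorted_list_of_set (states M)) (sorted_list_of_set (alphabet M))))]"

lemma encode_instance_faithful:
  assumes "(M, P) \<in> commuting_pair_instances" "(N, R) \<in> commuting_pair_instances"
    and "encode_instance (M, P) = encode_instance (N, R)"
  shows "states M = states N \<and> alphabet M = alphabet N \<and> P = R \<and>
    (\<forall>q \<in> states M. \<forall>a \<in> alphabet M.
       transition M q a = transition N q a \<and> production M q a = production N q a)"
proof -
  have fin: "finite (states M)" "finite (alphabet M)" "finite P"
    "finite (states N)" "finite (alphabet N)" "finite R"
    using assms(1,2)
    by (auto simp: commuting_pair_instances_def mealy_automaton_def intro: finite_subset)
  let ?L = "\<lambda>M. List.product (sorted_list_of_set (states M)) (sorted_list_of_set (alphabet M))"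
  let ?t = "\<lambda>M. \<lambda>(q, a). prod_encode (transition M q a, production M q a)"
  note eqs = assms(3)[unfolded encode_instance.simps list_encode_eq list.inject]
  have 1: "states M = states N" "alphabet M = alphabet N" "P = R"
    using eqs fin by (metis set_sorted_list_of_set)+
  have "map (?t M) (?L M) = map (?t N) (?L M)"
    using eqs 1 by metis
  then have 2: "\<forall>x \<in> set (?L M). ?t M x = ?t N x"
    by (simp only: map_eq_conv)
  have "transition M q a = transition N q a \<and> production M q a = production N q a"
    if "q \<in> states M" "a \<in> alphabet M" for q a
  proof -
    have "(q, a) \<in> set (?L M)" using that fin by simp
    then have "?t M (q, a) = ?t N (q, a)" using 2 by blast
    then show ?thesis by simp
  qed
  then show ?thesis using 1 by blast
qed

end

theory Submission
  imports Defs
begin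

text \<open>
  A commuting pair restricted to \<open>Q'\<close> is a cyclic tape together with a sequence of left-to-right
  passes over it which restores the tape, each pass starting and ending in the same state of \<open>Q'\<close>;
  an absorbing error state outside \<open>Q'\<close> makes the automaton as good as a partial one. The tape
  stores the registers of a nondeterministic counter program as the numbers of cells carrying the
  respective marks, and its control point in an end marker, so that one pass performs one instruction.
  Every such pass raises a potential bounded by the length of the tape, hence a cycle contains a
  reset pass, which is possible only at a halted program and writes the initial tape with the input
  \<open>x\<close> in register \<open>0\<close>. So there is a commuting pair iff the program halts on \<open>x\<close>.

  For undecidability, no universal program is needed. A decision procedure yields a recursive function
  that halts on a code \<open>c\<close> of a program iff the automaton for that program with input \<open>c\<close> has no
  commuting pair. Compiled into a counter program and applied to its own code, it gives a
  contradiction. The code may contain the whole transition table except for the states that write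
  the input, so the map from codes to instances involves no compilation.
\<close>

section \<open>Counter programs\<close>

datatype instr = Nop | Inc nat | Dec nat | Test nat

text \<open>Programs are in continuation form, so that a control point is simply the program still
  to be executed. \<open>Loop b p\<close> guesses how often to run \<open>b\<close> before
  \<open>p\<close>.\<close>

datatype prog = End | Act instr prog | Loop prog prog

type_synonym store = "nat \<Rightarrow> nat"

text \<open>\<open>Dec\<close> blocks on a zero register and \<open>Test\<close> on a nonzero one.
  This is the only dependence of control on data: a wrong guess gets stuck.\<close>

fun exec :: "instr \<Rightarrow> store rel" where
  "exec Nop = Id"
| "exec (Inc r) = {(s, s(r := Suc (s r))) | s. True}"
| "exec (Dec r) = {(s, s(r := s r - 1)) | s. s r \<noteq> 0}"
| "exec (Test r) = {(s, s) | s. s r = 0}"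

primrec sem :: "prog \<Rightarrow> store rel" where
  "sem End = Id"
| "sem (Act i p) = exec i O sem p"
| "sem (Loop b p) = (sem b)\<^sup>* O sem p"

primrec seq :: "prog \<Rightarrow> prog \<Rightarrow> prog"  (infixr \<open>;;\<close> 65) where
  "End ;; k = k"
| "Act i p ;; k = Act i (p ;; k)"
| "Loop b p ;; k = Loop b (p ;; k)"

lemma sem_seq: "sem (p ;; q) = sem p O sem q"
  by (induction p) auto

lemma seq_End [simp]: "p ;; End = p"
  by (induction p) auto

lemma seq_assoc: "(p ;; q) ;; k = p ;; (q ;; k)"
  by (induction p) auto

section \<open>Small-step control flow and its finitely many control points\<close>

inductive ctl_step :: "prog \<Rightarrow> instr \<Rightarrow> prog \<Rightarrow> bool" where
  Act: "ctl_step (Act i p) i p"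
| Exit: "ctl_step (Loop b p) Nop p"
| Enter: "ctl_step (Loop b p) Nop (b ;; Loop b p)"

inductive_cases ctl_step_elims:
  "ctl_step End i p"
  "ctl_step (Act j q) i p"
  "ctl_step (Loop b q) i p"

inductive run :: "prog \<Rightarrow> store \<Rightarrow> prog \<Rightarrow> store \<Rightarrow> bool" where
  refl: "run p s p s"
| step: "ctl_step p i q \<Longrightarrow> (s, t) \<in> exec i \<Longrightarrow> run q t p' s' \<Longrightarrow> run p s p' s'"

lemma run_trans: "run p s q t \<Longrightarrow> run q t p' s' \<Longrightarrow> run p s p' s'"
  by (induction rule: run.induct) (auto intro: run.step)

text \<open>The continuation \<open>k\<close> is general because the body of a loop has to run with
  the loop itself as continuation.\<close>

lemma sem_imp_run: "(s, s') \<in> sem p \<Longrightarrow> run (p ;; k) s k s'"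
proof (induction p arbitrary: s s' k)
  case End
  then show ?case by (auto intro: run.refl)
next
  case (Act i p)
  then show ?case by (auto intro: run.step ctl_step.Act)
next
  case (Loop b p)
  then obtain t where t: "(s, t) \<in> (sem b)\<^sup>*" "(t, s') \<in> sem p" by auto
  have "run (Loop b (p ;; k)) s (Loop b (p ;; k)) t"
    using t(1)
  proof (induction rule: converse_rtrancl_induct)
    case base
    show ?case by (rule run.refl)
  next
    case (step x y)
    have "run (Loop b (p ;; k)) x (Loop b (p ;; k)) y"
      by (rule run.step[OF ctl_step.Enter]) (auto intro: Loop.IH(1)[OF step(1)])
    then show ?case using step.IH by (rule run_trans)
  qed
  also have "run (Loop b (p ;; k)) t (p ;; k) t"
    by (rule run.step[OF ctl_step.Exit]) (auto intro: run.refl)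
  note run_trans[OF calculation this]
  from run_trans[OF this Loop.IH(2)[OF t(2)]] show ?case by simp
qed

lemma ctl_step_sem: "ctl_step p i q \<Longrightarrow> (s, t) \<in> exec i \<Longrightarrow> (t, s') \<in> sem q \<Longrightarrow> (s, s') \<in> sem p"
proof (induction rule: ctl_step.induct)
  case (Enter b p)
  then show ?case by (auto simp: sem_seq intro: converse_rtrancl_into_rtrancl)
qed auto

lemma run_imp_sem: "run p s End s' \<Longrightarrow> (s, s') \<in> sem p"
  by (induction p s "End" s' rule: run.induct) (auto intro: ctl_step_sem)

text \<open>These include all control points reachable from a program; those inside a loop body
  carry the loop as pending continuation. They become the end markers of the tape and therefore must
  be finite in number.\<close>

primrec subprogs :: "prog \<Rightarrow> prog set" where
  "subprogs End = {End}"
| "subprogs (Act i p) = insert (Act i p) (subprogs p)"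
| "subprogs (Loop b p) = insert (Loop b p) ((\<lambda>c. c ;; Loop b p) ` subprogs b \<union> subprogs p)"

lemma finite_subprogs: "finite (subprogs p)"
  by (induction p) auto

lemma self_in_subprogs: "p \<in> subprogs p"
  by (cases p) auto

text \<open>The second case arises at the end of a loop body, where \<open>End ;; k\<close> is
  \<open>k\<close>.\<close>

lemma ctl_step_seqD:
  "ctl_step (c ;; k) i d \<Longrightarrow> (\<exists>c'. ctl_step c i c' \<and> d = c' ;; k) \<or> c = End \<and> ctl_step k i d"
proof (cases c)
  case (Loop b p)
  assume "ctl_step (c ;; k) i d"
  then have "i = Nop \<and> (d = p ;; k \<or> d = (b ;; Loop b p) ;; k)"
    unfolding Loop by (auto elim!: ctl_step_elims simp: seq_assoc)
  then show ?thesis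
    unfolding Loop using ctl_step.Exit ctl_step.Enter by metis
qed (auto elim!: ctl_step_elims intro: ctl_step.Act)

lemma subprogs_closed: "c \<in> subprogs p \<Longrightarrow> ctl_step c i d \<Longrightarrow> d \<in> subprogs p"
proof (induction p arbitrary: c d)
  case (Loop b p)
  show ?case
  proof (cases "c \<in> subprogs p")
    case False
    then consider "c = Loop b p" | c' where "c' \<in> subprogs b" "c = c' ;; Loop b p"
      using Loop.prems(1) by auto
    then show ?thesis
    proof cases
      case 1
      then show ?thesis using Loop.prems(2) self_in_subprogs
        by (auto elim!: ctl_step_elims)
    next
      case 2
      then show ?thesis
        using Loop.prems(2) Loop.IH(1)[OF 2(1)] self_in_subprogs
        by (auto dest!: ctl_step_seqD elim!: ctl_step_elims)
    qed
  qed (use Loop in auto)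
qed (auto elim!: ctl_step_elims simp: self_in_subprogs)

section \<open>Compiling recursive functions\<close>

definition copy :: "nat \<Rightarrow> nat \<Rightarrow> nat \<Rightarrow> prog" where
  "copy r u t = Loop (Act (Dec r) (Act (Inc u) (Act (Inc t) End))) (Act (Test r)
     (Loop (Act (Dec t) (Act (Inc r) End)) (Act (Test t) End)))"

definition move :: "nat \<Rightarrow> nat \<Rightarrow> prog" where
  "move r u = Loop (Act (Dec r) (Act (Inc u) End)) (Act (Test r) End)"

definition clear :: "nat \<Rightarrow> prog" where
  "clear r = Loop (Act (Dec r) End) (Act (Test r) End)"

definition fail :: prog where
  "fail = Act (Inc 0) (Act (Test 0) End)"

text \<open>
  \<open>compile f rs u b\<close> reads the arguments of \<open>f\<close> from the registers \<open>rs\<close>, which it preserves,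
  and leaves the value in register \<open>u\<close>. It expects register \<open>u\<close> and all registers from \<open>b\<close> on to
  be zero, and clears the latter again. It has no terminating run where \<open>f\<close> is undefined; wrong
  guesses of the number of iterations of a loop are excluded by the test that follows it.
\<close>

fun compile :: "recf \<Rightarrow> nat list \<Rightarrow> nat \<Rightarrow> nat \<Rightarrow> prog"
and compile_list :: "recf list \<Rightarrow> nat list \<Rightarrow> nat \<Rightarrow> nat \<Rightarrow> prog" where
  "compile Zero rs u b = End"
| "compile Succ rs u b = (case rs of [r] \<Rightarrow> copy r u b ;; Act (Inc u) End | _ \<Rightarrow> fail)"
| "compile (Proj i) rs u b = (if i < length rs then copy (rs ! i) u b else fail)"
| "compile (Comp f gs) rs u b =
     compile_list gs rs b (b + length gs) ;;
     compile f [b..<b + length gs] u (b + length gs) ;;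
     foldr (\<lambda>r p. clear r ;; p) [b..<b + length gs] End"
| "compile (PrimRec f g) rs u b = (case rs of [] \<Rightarrow> fail | r # rs \<Rightarrow>
     copy r b (Suc b) ;; compile f rs u (b + 3) ;;
     Loop (Act (Dec b) (compile g (Suc b # u # rs) (b + 2) (b + 3) ;;
       clear u ;; move (b + 2) u ;; Act (Inc (Suc b)) End))
     (Act (Test b) (clear (Suc b))))"
| "compile (Mu f) rs u b =
     Loop (compile f (u # rs) b (Suc b) ;; Act (Dec b) (clear b ;; Act (Inc u) End))
     (compile f (u # rs) b (Suc b) ;; Act (Test b) End)"
| "compile_list [] rs u b = End"
| "compile_list (g # gs) rs u b = compile g rs u b ;; compile_list gs rs (Suc u) b"

lemma sem_countdown:
  assumes body: "\<And>s s'. (s, s') \<in> sem b \<longleftrightarrow> s r \<noteq> 0 \<and> s' = f s"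
    and f: "\<And>s. s r \<noteq> 0 \<Longrightarrow> f s r = s r - 1"
  shows "(s, s') \<in> sem (Loop b (Act (Test r) k)) \<longleftrightarrow> ((f ^^ s r) s, s') \<in> sem k"
proof -
  have iter: "(s, t) \<in> (sem b)\<^sup>* \<and> t r = 0 \<longleftrightarrow> t = (f ^^ s r) s" for t
  proof (induction "s r" arbitrary: s)
    case 0
    then have "s r = 0" by simp
    have "(s, t) \<in> (sem b)\<^sup>* \<longleftrightarrow> t = s"
      using body[of s] \<open>s r = 0\<close> by (metis converse_rtranclE rtrancl.rtrancl_refl)
    then show ?case using \<open>s r = 0\<close> by auto
  next
    case (Suc n)
    then have 1: "s r = Suc n" "f s r = n" "(s, f s) \<in> sem b"
      using body[of s] f[of s] by auto
    have "(s, t) \<in> (sem b)\<^sup>* \<and> t r = 0 \<longleftrightarrow> (f s, t) \<in> (sem b)\<^sup>* \<and> t r = 0"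
      using body[of s] 1 by (metis converse_rtranclE converse_rtrancl_into_rtrancl nat.simps(3))
    also have "\<dots> \<longleftrightarrow> t = (f ^^ n) (f s)"
      using Suc.hyps(1)[of "f s"] 1(2) by simp
    also have "(f ^^ n) (f s) = (f ^^ s r) s"
      unfolding 1(1) by (simp add: funpow_swap1)
    finally show ?case .
  qed
  have "(s, s') \<in> sem (Loop b (Act (Test r) k)) \<longleftrightarrow>
      (\<exists>t. ((s, t) \<in> (sem b)\<^sup>* \<and> t r = 0) \<and> (t, s') \<in> sem k)"
    by auto
  then show ?thesis unfolding iter by simp
qed

lemma sem_clear: "(s, s') \<in> sem (clear r) \<longleftrightarrow> s' = s(r := 0)"
proof -
  define f where "f = (\<lambda>s::store. s(r := s r - 1))"
  have iter: "(f ^^ n) s = s(r := s r - n)" for n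
    by (induction n) (auto simp: f_def)
  have body: "(s, s') \<in> sem (Act (Dec r) End) \<longleftrightarrow> s r \<noteq> 0 \<and> s' = f s" for s s'
    by (auto simp: f_def)
  have "f s r = s r - 1" for s
    by (simp add: f_def)
  with body have "(s, s') \<in> sem (clear r) \<longleftrightarrow> ((f ^^ s r) s, s') \<in> sem End"
    unfolding clear_def by (rule sem_countdown)
  then show ?thesis by (auto simp: iter)
qed

lemma sem_move:
  assumes "r \<noteq> u"
  shows "(s, s') \<in> sem (move r u) \<longleftrightarrow> s' = s(r := 0, u := s u + s r)"
proof -
  define f where "f = (\<lambda>s::store. s(r := s r - 1, u := Suc (s u)))"
  have iter: "(f ^^ n) s = s(r := s r - n, u := s u + n)" for n
    using assms by (induction n) (auto simp: f_def)
  have body: "(s, s') \<in> sem (Act (Dec r) (Act (Inc u) End)) \<longleftrightarrow> s r \<noteq> 0 \<and> s' = f s" for s s'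
    using assms by (auto simp: f_def relcomp_unfold)
  have "f s r = s r - 1" for s
    using assms by (simp add: f_def)
  with body have "(s, s') \<in> sem (move r u) \<longleftrightarrow> ((f ^^ s r) s, s') \<in> sem End"
    unfolding move_def by (rule sem_countdown)
  then show ?thesis by (auto simp: iter)
qed

text \<open>The first loop empties \<open>r\<close> into both \<open>u\<close> and \<open>t\<close>;
  the second is \<open>move t r\<close>, which restores \<open>r\<close> and clears
  \<open>t\<close>.\<close>

lemma sem_copy:
  assumes "distinct [r, u, t]" "s t = 0"
  shows "(s, s') \<in> sem (copy r u t) \<longleftrightarrow> s' = s(u := s u + s r)"
proof -
  define f where "f = (\<lambda>s::store. s(r := s r - 1, u := Suc (s u), t := Suc (s t)))"
  have iter: "(f ^^ n) s = s(r := s r - n, u := s u + n, t := s t + n)" for n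
    using assms by (induction n) (auto simp: f_def)
  have body: "(s, s') \<in> sem (Act (Dec r) (Act (Inc u) (Act (Inc t) End))) \<longleftrightarrow> s r \<noteq> 0 \<and> s' = f s"
    for s s'
    using assms by (auto simp: f_def relcomp_unfold)
  have "f s r = s r - 1" for s
    using assms by (simp add: f_def)
  with body have "(s, s') \<in> sem (copy r u t) \<longleftrightarrow> ((f ^^ s r) s, s') \<in> sem (move t r)"
    unfolding copy_def move_def[symmetric] by (rule sem_countdown)
  also have "\<dots> \<longleftrightarrow> s' = s(u := s u + s r)"
    using assms by (subst sem_move) (auto simp: iter)
  finally show ?thesis .
qed

lemma sem_fail: "sem fail = {}"
  by (auto simp: fail_def)

lemma relcomp_iff:
  "(\<And>t. (s, t) \<in> R \<longleftrightarrow> P t) \<Longrightarrow> (s, s') \<in> R O R' \<longleftrightarrow> (\<exists>t. P t \<and> (t, s') \<in> R')"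
  by auto

lemma relcomp_iff_ex:
  "(\<And>t. (s, t) \<in> R \<longleftrightarrow> (\<exists>y. P y \<and> t = h y)) \<Longrightarrow>
    (s, s') \<in> R O R' \<longleftrightarrow> (\<exists>y. P y \<and> (h y, s') \<in> R')"
  by (auto simp: relcomp_unfold)

lemma sem_clears:
  "(s, s') \<in> sem (foldr (\<lambda>r p. clear r ;; p) rs End) \<longleftrightarrow> s' = (\<lambda>r. if r \<in> set rs then 0 else s r)"
proof (induction rs arbitrary: s)
  case (Cons a rs)
  have "(\<lambda>r. if r \<in> set rs then 0 else (s(a := 0)) r) = (\<lambda>r. if r \<in> set (a # rs) then 0 else s r)"
    by auto
  then show ?case by (simp add: sem_seq relcomp_unfold sem_clear Cons.IH)
qed auto

text \<open>Register \<open>b\<close> holds the remaining rounds, \<open>Suc b\<close> the index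
  \<open>j\<close>, and \<open>u\<close> the value at \<open>j\<close>. The next value first goes to
  \<open>b + 2\<close>, since \<open>g\<close> still reads \<open>u\<close>.\<close>

lemma sem_compile_PrimRec_body:
  assumes rs: "\<forall>r\<in>set rs. r < b" "u < b" "u \<notin> set rs" "\<forall>r\<ge>b. s r = 0"
    and g: "\<And>t t'. \<forall>r\<ge>b + 3. t r = 0 \<Longrightarrow> t (b + 2) = 0 \<Longrightarrow>
      (t, t') \<in> sem (compile g (Suc b # u # rs) (b + 2) (b + 3)) \<longleftrightarrow>
      (\<exists>y. rec_eval g (map t (Suc b # u # rs)) y \<and> t' = t(b + 2 := y))"
  shows "(s(b := n, Suc b := j, u := y), t) \<in> sem (Act (Dec b) (compile g (Suc b # u # rs) (b + 2) (b + 3) ;;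
       clear u ;; move (b + 2) u ;; Act (Inc (Suc b)) End)) \<longleftrightarrow>
     n \<noteq> 0 \<and> (\<exists>z. rec_eval g (j # y # map s rs) z \<and> t = s(b := n - 1, Suc b := Suc j, u := z))"
proof -
  let ?S = "\<lambda>n j y. s(b := n, Suc b := j, u := y)"
  have 1: "(?S n j y, t) \<in> exec (Dec b) \<longleftrightarrow> n \<noteq> 0 \<and> t = ?S (n - 1) j y" for t
    using rs by (auto simp: fun_upd_twist)
  have *: "map (?S m j y) (Suc b # u # rs) = j # y # map s rs" for m
    using rs by auto
  have 2: "(?S m j y, t) \<in> sem (compile g (Suc b # u # rs) (b + 2) (b + 3)) \<longleftrightarrow>
      (\<exists>z. rec_eval g (j # y # map s rs) z \<and> t = (?S m j y)(b + 2 := z))" for m t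
    using rs by (subst g) (simp_all only: *, auto)
  have 3: "((?S m j y)(b + 2 := z), t) \<in> sem (clear u) O sem (move (b + 2) u) \<longleftrightarrow>
      t = ?S m j z" for m z t
  proof -
    let ?A = "(?S m j y)(b + 2 := z, u := 0)"
    have "((?S m j y)(b + 2 := z), t) \<in> sem (clear u) O sem (move (b + 2) u) \<longleftrightarrow>
        (?A, t) \<in> sem (move (b + 2) u)"
      by (simp only: relcomp_unfold sem_clear mem_Collect_eq prod.case simp_thms)
    also have "\<dots> \<longleftrightarrow> t = ?A(b + 2 := 0, u := ?A u + ?A (b + 2))"
      using rs by (intro sem_move) simp
    also have "?A(b + 2 := 0, u := ?A u + ?A (b + 2)) = ?S m j z"
      using rs by (auto simp: fun_eq_iff)
    finally show ?thesis .
  qed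
  have 4: "(?S m j y, t) \<in> exec (Inc (Suc b)) \<longleftrightarrow> t = ?S m (Suc j) y" for m t y
    using rs by (auto simp: fun_upd_twist)
  have "(?S n j y, t) \<in> sem (Act (Dec b) (compile g (Suc b # u # rs) (b + 2) (b + 3) ;;
       clear u ;; move (b + 2) u ;; Act (Inc (Suc b)) End)) \<longleftrightarrow>
    (?S n j y, t) \<in> exec (Dec b) O sem (compile g (Suc b # u # rs) (b + 2) (b + 3)) O
      (sem (clear u) O sem (move (b + 2) u)) O exec (Inc (Suc b))"
    by (simp add: sem_seq O_assoc)
  also have "\<dots> \<longleftrightarrow> n \<noteq> 0 \<and> (?S (n - 1) j y, t) \<in>
      sem (compile g (Suc b # u # rs) (b + 2) (b + 3)) O
      (sem (clear u) O sem (move (b + 2) u)) O exec (Inc (Suc b))"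
    by (subst relcomp_iff[OF 1]) metis
  also have "\<dots> \<longleftrightarrow> n \<noteq> 0 \<and> (\<exists>z. rec_eval g (j # y # map s rs) z \<and>
      ((?S (n - 1) j y)(b + 2 := z), t) \<in>
      (sem (clear u) O sem (move (b + 2) u)) O exec (Inc (Suc b)))"
    by (subst relcomp_iff[OF 2]) metis
  also have "\<dots> \<longleftrightarrow> n \<noteq> 0 \<and> (\<exists>z. rec_eval g (j # y # map s rs) z \<and> t = ?S (n - 1) (Suc j) z)"
    by (subst relcomp_iff[OF 3]) (simp only: 4 simp_thms)
  finally show ?thesis .
qed

text \<open>\<open>S n j y\<close> abstracts the three registers of the loop. Remaining rounds plus
  index stay constant, and \<open>y\<close> is always the value of the recursion at
  \<open>j\<close>.\<close>

lemma sem_compile_PrimRec_loop: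
  assumes "\<And>n j y t. (S n j y, t) \<in> sem p \<longleftrightarrow>
      n \<noteq> 0 \<and> (\<exists>z. rec_eval g (j # y # xs) z \<and> t = S (n - 1) (Suc j) z)"
    and "rec_eval f xs y0" and S: "\<And>n j y. S n j y b = n"
  shows "(S n 0 y0, t) \<in> (sem p)\<^sup>* \<and> t b = 0 \<longleftrightarrow>
      (\<exists>y. rec_eval (PrimRec f g) (n # xs) y \<and> t = S 0 n y)"
proof
  assume t: "(S n 0 y0, t) \<in> (sem p)\<^sup>* \<and> t b = 0"
  then have "(S n 0 y0, t) \<in> (sem p)\<^sup>*" ..
  then have "\<exists>j\<le>n. \<exists>y. rec_eval (PrimRec f g) (j # xs) y \<and> t = S (n - j) j y"
  proof (induction rule: rtrancl_induct)
    case base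
    have "rec_eval (PrimRec f g) (0 # xs) y0" using assms(2) by (rule rec_eval.PrimRec_0)
    then show ?case by (intro exI[of _ 0]) auto
  next
    case (step t t')
    then obtain j y where j: "j \<le> n" "rec_eval (PrimRec f g) (j # xs) y" "t = S (n - j) j y" by blast
    with step(2) assms(1) obtain z where "n - j \<noteq> 0" "rec_eval g (j # y # xs) z"
        "t' = S (n - j - 1) (Suc j) z"
      by auto
    with j have "rec_eval (PrimRec f g) (Suc j # xs) z" "Suc j \<le> n" "t' = S (n - Suc j) (Suc j) z"
      by (auto intro: rec_eval.PrimRec_Suc)
    then show ?case by blast
  qed
  then obtain j y where "j \<le> n" "rec_eval (PrimRec f g) (j # xs) y" "t = S (n - j) j y" by blast
  \<comment> \<open>The final test for zero remaining rounds excludes leaving the loop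
    early.\<close>
  moreover from this t S have "j = n" by auto
  ultimately show "\<exists>y. rec_eval (PrimRec f g) (n # xs) y \<and> t = S 0 n y" by auto
next
  assume "\<exists>y. rec_eval (PrimRec f g) (n # xs) y \<and> t = S 0 n y"
  then obtain y where y: "rec_eval (PrimRec f g) (n # xs) y" "t = S 0 n y" by blast
  \<comment> \<open>The \<open>m\<close> rounds left over allow the induction on \<open>j\<close> to
    extend the path at its end.\<close>
  have "(S (m + j) 0 y0, S m j y) \<in> (sem p)\<^sup>*" if "rec_eval (PrimRec f g) (j # xs) y" for j m y
    using that
  proof (induction j arbitrary: y m)
    case 0
    then have "rec_eval f xs y" by (auto elim: rec_eval_elims)
    then have "y = y0" using assms(2) by (rule rec_eval_deterministic)
    then show ?case by simp
  next
    case (Suc j)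
    from Suc.prems obtain y' where y': "rec_eval (PrimRec f g) (j # xs) y'"
        "rec_eval g (j # y' # xs) y"
      by (rule rec_eval_elims)
    then have "(S (Suc m) j y', S m (Suc j) y) \<in> sem p"
      unfolding assms(1) by (intro conjI exI[of _ y]) simp_all
    with Suc.IH[OF y'(1), of "Suc m"] show ?case by (auto intro: rtrancl_into_rtrancl)
  qed
  from this[OF y(1), of 0] y(2) S show "(S n 0 y0, t) \<in> (sem p)\<^sup>* \<and> t b = 0" by simp
qed

text \<open>\<open>S n m\<close> stands for the candidate \<open>n\<close> with the value
  \<open>m\<close> of \<open>f\<close> in register \<open>b\<close>. A round is completed only if
  \<open>f\<close> has a nonzero value, and the part after the loop only if the value is zero, so
  the exit is forced exactly at the least zero.\<close>

lemma sem_compile_Mu_loop: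
  assumes p: "\<And>n t. (S n 0, t) \<in> sem p \<longleftrightarrow> (\<exists>y. rec_eval f (n # xs) y \<and> t = S n y)"
    and q: "\<And>n m t. (S n m, t) \<in> sem q \<longleftrightarrow> m \<noteq> 0 \<and> t = S (Suc n) 0"
    and S: "\<And>n m. S n m b = m"
  shows "(S 0 0, t) \<in> sem (Loop (p ;; q) (p ;; Act (Test b) End)) \<longleftrightarrow>
    (\<exists>n. rec_eval (Mu f) xs n \<and> t = S n 0)"
proof -
  let ?P = "\<lambda>n. \<forall>m<n. \<exists>y. rec_eval f (m # xs) (Suc y)"
  have first: "(S n 0, t) \<in> sem p O R \<longleftrightarrow> (\<exists>y. rec_eval f (n # xs) y \<and> (S n y, t) \<in> R)" for n t R
    by (rule relcomp_iff_ex) (rule p)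
  have iter: "(S n 0, t) \<in> sem (p ;; q) \<longleftrightarrow> (\<exists>y. rec_eval f (n # xs) (Suc y)) \<and> t = S (Suc n) 0" for n t
    unfolding sem_seq first q by (auto simp: neq0_conv gr0_conv_Suc)
  have 1: "\<exists>n. ?P n \<and> t = S n 0" if "(S 0 0, t) \<in> (sem (p ;; q))\<^sup>*" for t
    using that
  proof (induction rule: rtrancl_induct)
    case base
    show ?case by (intro exI[of _ 0]) simp
  next
    case (step t t')
    then obtain n where "?P n" "(S n 0, t') \<in> sem (p ;; q)" by blast
    then have "?P (Suc n) \<and> t' = S (Suc n) 0" by (simp add: iter less_Suc_eq)
    then show ?case by blast
  qed
  have 2: "(S 0 0, S n 0) \<in> (sem (p ;; q))\<^sup>*" if "?P n" for n
    using that
  proof (induction n)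
    case (Suc n)
    then have "(S n 0, S (Suc n) 0) \<in> sem (p ;; q)" by (simp add: iter)
    moreover have "(S 0 0, S n 0) \<in> (sem (p ;; q))\<^sup>*" using Suc by simp
    ultimately show ?case by (rule rtrancl_into_rtrancl[rotated])
  qed simp
  have star: "(S 0 0, t) \<in> (sem (p ;; q))\<^sup>* \<longleftrightarrow> (\<exists>n. ?P n \<and> t = S n 0)" for t
  proof
    assume "\<exists>n. ?P n \<and> t = S n 0"
    then obtain n where "?P n" "t = S n 0" by blast
    then show "(S 0 0, t) \<in> (sem (p ;; q))\<^sup>*" by (simp only: 2)
  qed (rule 1)
  have exit: "(S n y, t) \<in> sem (Act (Test b) End) \<longleftrightarrow> y = 0 \<and> t = S n 0" for n y t
    using S by auto
  have 3: "(S n 0, t) \<in> sem (p ;; Act (Test b) End) \<longleftrightarrow> rec_eval f (n # xs) 0 \<and> t = S n 0" for n t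
    unfolding sem_seq first exit by simp
  have 4: "rec_eval (Mu f) xs n \<longleftrightarrow> ?P n \<and> rec_eval f (n # xs) 0" for n
    by (auto intro: rec_eval.Mu elim!: rec_eval_elims(7))
  have "(S 0 0, t) \<in> sem (Loop (p ;; q) (p ;; Act (Test b) End)) \<longleftrightarrow>
      (\<exists>n. ?P n \<and> (S n 0, t) \<in> sem (p ;; Act (Test b) End))"
    unfolding sem.simps(3) by (rule relcomp_iff_ex) (rule star)
  then show ?thesis
    unfolding 3 4 by simp
qed

text \<open>The compiled program evaluates \<open>f\<close> before entering the loop, so a value of
  \<open>PrimRec f g\<close> has to provide one of \<open>f\<close>.\<close>

lemma rec_eval_PrimRec_base: "rec_eval (PrimRec f g) (n # xs) y \<Longrightarrow> \<exists>y. rec_eval f xs y"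
  by (induction n arbitrary: y) (auto elim: rec_eval_elims)

text \<open>An equivalence is proved because undefined values must exclude every terminating run.
  The two statements follow the mutual recursion of the compiler.\<close>

lemma sem_compile:
  "\<forall>r\<in>set rs. r < b \<Longrightarrow> u < b \<Longrightarrow> u \<notin> set rs \<Longrightarrow> s u = 0 \<Longrightarrow> \<forall>r\<ge>b. s r = 0 \<Longrightarrow>
    (s, s') \<in> sem (compile f rs u b) \<longleftrightarrow> (\<exists>y. rec_eval f (map s rs) y \<and> s' = s(u := y))"
  and sem_compile_list:
  "\<forall>r\<in>set rs. r < u \<Longrightarrow> u + length gs \<le> b \<Longrightarrow> \<forall>r\<ge>u. s r = 0 \<Longrightarrow>
    (s, s') \<in> sem (compile_list gs rs u b) \<longleftrightarrow>
      (\<exists>ys. list_all2 (\<lambda>g y. rec_eval g (map s rs) y) gs ys \<and>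
        s' = (\<lambda>r. if u \<le> r \<and> r < u + length ys then ys ! (r - u) else s r))"
proof (induction f rs u b and gs rs u b arbitrary: s s' and s s' rule: compile_compile_list.induct)
  case (1 rs u b)
  have "rec_eval Zero xs y \<longleftrightarrow> y = 0" for xs y
    by (auto intro: rec_eval.Zero elim: rec_eval_elims)
  moreover have "s(u := 0) = s" using 1 by auto
  ultimately show ?case unfolding compile.simps sem.simps pair_in_Id_conv by metis
next
  case (2 rs u b)
  show ?case
  proof (cases "\<exists>r. rs = [r]")
    case True
    then obtain r where r: "rs = [r]" by blast
    with 2 have "(s, s') \<in> sem (compile Succ rs u b) \<longleftrightarrow> s' = s(u := Suc (s r))"
      by (auto simp: sem_seq relcomp_unfold sem_copy)
    moreover have "rec_eval Succ [x] y \<longleftrightarrow> y = Suc x" for x y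
      by (auto intro: rec_eval.Succ elim: rec_eval_elims)
    ultimately show ?thesis using r by (metis list.simps(8,9))
  next
    case False
    then have "sem (compile Succ rs u b) = {}" by (auto simp: sem_fail split: list.split)
    moreover have "\<not> rec_eval Succ (map s rs) y" for y
      using False by (auto elim!: rec_eval_elims(2))
    ultimately show ?thesis by simp
  qed
next
  case (3 i rs u b)
  show ?case
  proof (cases "i < length rs")
    case True
    then have "distinct [rs ! i, u, b]" using 3 by (auto dest: nth_mem)
    then have "(s, s') \<in> sem (compile (Proj i) rs u b) \<longleftrightarrow> s' = s(u := s (rs ! i))"
      using 3 True by (simp add: sem_copy)
    moreover have "rec_eval (Proj i) (map s rs) (s (rs ! i))"
      using True rec_eval.Proj[of i "map s rs"] by simp
    then have "rec_eval (Proj i) (map s rs) y \<longleftrightarrow> y = s (rs ! i)" for y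
      by (auto dest: rec_eval_deterministic)
    ultimately show ?thesis by metis
  qed (auto simp: sem_fail elim!: rec_eval_elims(3))
next
  case (4 f gs rs u b)
  let ?n = "length gs"
  let ?S = "\<lambda>ys r. if b \<le> r \<and> r < b + length ys then ys ! (r - b) else s r"
  have gs: "(s, t) \<in> sem (compile_list gs rs b (b + ?n)) \<longleftrightarrow>
      (\<exists>ys. list_all2 (\<lambda>g y. rec_eval g (map s rs) y) gs ys \<and> t = ?S ys)" for t
    using 4 by (subst "4.IH"(1)) auto
  \<comment> \<open>The arguments of \<open>f\<close> occupy the registers from \<open>b\<close> to
    below \<open>b + ?n\<close>, so its work space starts at \<open>b + ?n\<close>.\<close>
  have f: "(?S ys, t) \<in> sem (compile f [b..<b + ?n] u (b + ?n)) \<longleftrightarrow>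
      (\<exists>z. rec_eval f ys z \<and> t = (?S ys)(u := z))" if "length ys = ?n" for ys t
  proof -
    have "map (?S ys) [b..<b + ?n] = ys"
      using that by (auto intro!: nth_equalityI)
    then show ?thesis using 4 that by (subst "4.IH"(2)) auto
  qed
  have c: "(\<lambda>r. if r \<in> set [b..<b + ?n] then 0 else ((?S ys)(u := z)) r) = s(u := z)"
    if "length ys = ?n" for ys z
    using 4 that by auto
  have fc: "(?S ys, s') \<in> sem (compile f [b..<b + ?n] u (b + ?n)) O
      sem (foldr (\<lambda>r p. clear r ;; p) [b..<b + ?n] End) \<longleftrightarrow>
      (\<exists>z. rec_eval f ys z \<and> s' = s(u := z))" if "length ys = ?n" for ys
    unfolding relcomp_iff_ex[where h = "\<lambda>z. (?S ys)(u := z)", OF f[OF that]] sem_clears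
    by (simp only: c[OF that])
  have "(s, s') \<in> sem (compile (Comp f gs) rs u b) \<longleftrightarrow>
      (\<exists>ys. list_all2 (\<lambda>g y. rec_eval g (map s rs) y) gs ys \<and>
        (?S ys, s') \<in> sem (compile f [b..<b + ?n] u (b + ?n)) O
        sem (foldr (\<lambda>r p. clear r ;; p) [b..<b + ?n] End))"
    unfolding compile.simps sem_seq by (rule relcomp_iff_ex) (rule gs)
  also have "\<dots> \<longleftrightarrow> (\<exists>ys. list_all2 (\<lambda>g y. rec_eval g (map s rs) y) gs ys \<and>
      (\<exists>z. rec_eval f ys z \<and> s' = s(u := z)))"
    by (metis (no_types, lifting) fc list_all2_lengthD)
  also have "\<dots> \<longleftrightarrow> (\<exists>z. rec_eval (Comp f gs) (map s rs) z \<and> s' = s(u := z))"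
    by (blast intro: rec_eval.Comp elim: rec_eval_elims(4))
  finally show ?case .
next
  case (5 f g rs' u b)
  show ?case
  proof (cases rs')
    case Nil
    then show ?thesis by (auto simp: sem_fail elim: rec_eval.cases)
  next
    case (Cons r rs)
    define S where "S = (\<lambda>n j y. s(b := n, Suc b := j, u := y))"
    define p where "p = Act (Dec b) (compile g (Suc b # u # rs) (b + 2) (b + 3) ;;
       clear u ;; move (b + 2) u ;; Act (Inc (Suc b)) End)"
    have rs: "\<forall>r\<in>set rs. r < b" "u \<notin> set rs" "r < b" "r \<noteq> u" "u < b" "s u = 0" "\<forall>r\<ge>b. s r = 0"
      using 5 unfolding Cons by auto
    have [simp]: "map (s(b := n)) rs = map s rs" for n
      using rs by auto
    \<comment> \<open>Register \<open>Suc b\<close> is still zero, so the index starts at 0.\<close>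
    have S0: "s(b := s r, u := y) = S (s r) 0 y" for y
      using rs by (auto simp: S_def)
    have copy: "(s, t) \<in> sem (copy r b (Suc b)) \<longleftrightarrow> t = s(b := s r)" for t
      using rs by (subst sem_copy) auto
    have f: "(s(b := s r), t) \<in> sem (compile f rs u (b + 3)) \<longleftrightarrow>
        (\<exists>y. rec_eval f (map s rs) y \<and> t = S (s r) 0 y)" for t
      using rs by (subst "5.IH"(1)[OF Cons]) (auto simp: S0)
    have body: "(S n j y, t) \<in> sem p \<longleftrightarrow>
        n \<noteq> 0 \<and> (\<exists>z. rec_eval g (j # y # map s rs) z \<and> t = S (n - 1) (Suc j) z)" for n j y t
      unfolding S_def p_def
    proof (rule sem_compile_PrimRec_body)
      fix t t' :: store assume "\<forall>r\<ge>b + 3. t r = 0" "t (b + 2) = 0"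
      with rs show "(t, t') \<in> sem (compile g (Suc b # u # rs) (b + 2) (b + 3)) \<longleftrightarrow>
          (\<exists>y. rec_eval g (map t (Suc b # u # rs)) y \<and> t' = t(b + 2 := y))"
        by (intro "5.IH"(2)[OF Cons]) auto
    qed (use rs in auto)
    have result: "(S 0 (s r) y)(Suc b := 0) = s(u := y)" for y
      using rs by (auto simp: S_def fun_eq_iff)
    have loop: "(S (s r) 0 y0, s') \<in> sem (Loop p (Act (Test b) (clear (Suc b)))) \<longleftrightarrow>
        (\<exists>y. rec_eval (PrimRec f g) (s r # map s rs) y \<and> s' = s(u := y))"
      if "rec_eval f (map s rs) y0" for y0
    proof -
      have "(S (s r) 0 y0, s') \<in> sem (Loop p (Act (Test b) (clear (Suc b)))) \<longleftrightarrow>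
          (\<exists>t. ((S (s r) 0 y0, t) \<in> (sem p)\<^sup>* \<and> t b = 0) \<and> s' = t(Suc b := 0))"
        by (auto simp: relcomp_unfold sem_clear)
      also have "\<dots> \<longleftrightarrow> (\<exists>t. (\<exists>y. rec_eval (PrimRec f g) (s r # map s rs) y \<and> t = S 0 (s r) y) \<and>
          s' = t(Suc b := 0))"
        by (subst sem_compile_PrimRec_loop[OF body that]) (use rs in \<open>auto simp: S_def\<close>)
      also have "\<dots> \<longleftrightarrow> (\<exists>y. rec_eval (PrimRec f g) (s r # map s rs) y \<and>
          s' = (S 0 (s r) y)(Suc b := 0))"
        by blast
      also have "\<dots> \<longleftrightarrow> (\<exists>y. rec_eval (PrimRec f g) (s r # map s rs) y \<and> s' = s(u := y))"
        by (simp only: result)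
      finally show ?thesis .
    qed
    have "(s, s') \<in> sem (compile (PrimRec f g) rs' u b) \<longleftrightarrow>
        (s, s') \<in> sem (copy r b (Suc b)) O sem (compile f rs u (b + 3)) O
          sem (Loop p (Act (Test b) (clear (Suc b))))"
      unfolding Cons compile.simps list.case sem_seq p_def by (simp only: sem_seq O_assoc)
    also have "\<dots> \<longleftrightarrow> (s(b := s r), s') \<in> sem (compile f rs u (b + 3)) O
          sem (Loop p (Act (Test b) (clear (Suc b))))"
      by (subst relcomp_iff[OF copy]) simp
    also have "\<dots> \<longleftrightarrow> (\<exists>y0. rec_eval f (map s rs) y0 \<and>
        (S (s r) 0 y0, s') \<in> sem (Loop p (Act (Test b) (clear (Suc b)))))"
      by (rule relcomp_iff_ex) (rule f)
    also have "\<dots> \<longleftrightarrow> (\<exists>y. rec_eval (PrimRec f g) (s r # map s rs) y \<and> s' = s(u := y))"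
      using loop rec_eval_PrimRec_base[of f g "s r" "map s rs"] by metis
    finally show ?thesis unfolding Cons list.map .
  qed
next
  case (6 f rs u b)
  define S where "S = (\<lambda>n y. s(u := n, b := y))"
  have rs: "\<forall>r\<in>set rs. r < b" "u \<notin> set rs" "u < b" "s u = 0" "\<forall>r\<ge>b. s r = 0"
    using 6 by auto
  have m: "map (S n y) (u # rs) = n # map s rs" for n y
    using rs by (auto simp: S_def)
  have p: "(S n 0, t) \<in> sem (compile f (u # rs) b (Suc b)) \<longleftrightarrow>
      (\<exists>y. rec_eval f (n # map s rs) y \<and> t = S n y)" for n t
    using rs unfolding m[symmetric, of n 0] by (subst "6.IH"(1)) (auto simp: S_def)
  have q: "(S n m, t) \<in> sem (Act (Dec b) (clear b ;; Act (Inc u) End)) \<longleftrightarrow>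
      m \<noteq> 0 \<and> t = S (Suc n) 0" for n m t
  proof -
    have "(S n m, t) \<in> sem (Act (Dec b) (clear b ;; Act (Inc u) End)) \<longleftrightarrow>
        m \<noteq> 0 \<and> t = (S n m)(b := m - 1, b := 0, u := Suc n)"
      using rs by (auto simp: sem_seq relcomp_unfold sem_clear S_def)
    also have "(S n m)(b := m - 1, b := 0, u := Suc n) = S (Suc n) 0"
      using rs by (auto simp: S_def)
    finally show ?thesis .
  qed
  have "(S 0 0, s') \<in> sem (compile (Mu f) rs u b) \<longleftrightarrow> (\<exists>n. rec_eval (Mu f) (map s rs) n \<and> s' = S n 0)"
    unfolding compile.simps by (rule sem_compile_Mu_loop[OF p q]) (simp add: S_def)
  moreover have "S n 0 = s(u := n)" for n
    using rs by (auto simp: S_def)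
  moreover have "S 0 0 = s"
    using rs by (auto simp: S_def)
  ultimately show ?case by metis
next
  case (7 rs u b)
  then show ?case by auto
next
  case (8 g gs rs u b)
  let ?S = "\<lambda>u s ys r. if u \<le> r \<and> r < u + length ys then ys ! (r - u) else s r"
  have g: "(s, t) \<in> sem (compile g rs u b) \<longleftrightarrow> (\<exists>y. rec_eval g (map s rs) y \<and> t = s(u := y))" for t
    using 8 by (intro "8.IH"(1)) auto
  have m: "map (s(u := y)) rs = map s rs" for y
    using 8 by auto
  have gs: "(s(u := y), t) \<in> sem (compile_list gs rs (Suc u) b) \<longleftrightarrow>
      (\<exists>ys. list_all2 (\<lambda>g y. rec_eval g (map s rs) y) gs ys \<and> t = ?S (Suc u) (s(u := y)) ys)" for y t
    using 8 unfolding m[symmetric, of y] by (intro "8.IH"(2)) auto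
  have S: "?S (Suc u) (s(u := y)) ys = ?S u s (y # ys)" for y ys
    by (auto simp: fun_eq_iff nth_Cons')
  have "(s, s') \<in> sem (compile_list (g # gs) rs u b) \<longleftrightarrow>
      (\<exists>y. rec_eval g (map s rs) y \<and> (s(u := y), s') \<in> sem (compile_list gs rs (Suc u) b))"
    unfolding compile_list.simps sem_seq by (rule relcomp_iff_ex) (rule g)
  also have "\<dots> \<longleftrightarrow> (\<exists>ys. list_all2 (\<lambda>g y. rec_eval g (map s rs) y) (g # gs) ys \<and> s' = ?S u s ys)"
    unfolding gs S list_all2_Cons1 by blast
  finally show ?case .
qed

lemma run_iff_sem: "run p s End s' \<longleftrightarrow> (s, s') \<in> sem p"
  using run_imp_sem sem_imp_run[where k = End] by auto

definition input_store :: "nat \<Rightarrow> store" where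
  "input_store x = (\<lambda>r. if r = 0 then x else 0)"

lemma run_compile_iff:
  "(\<exists>s'. run (compile f [0] 1 2) (input_store x) End s') \<longleftrightarrow> (\<exists>y. rec_eval f [x] y)"
proof -
  have "run (compile f [0] 1 2) (input_store x) End s' \<longleftrightarrow>
      (\<exists>y. rec_eval f (map (input_store x) [0]) y \<and> s' = (input_store x)(1 := y))" for s'
    unfolding run_iff_sem by (rule sem_compile) (auto simp: input_store_def)
  then show ?thesis by (auto simp: input_store_def)
qed

section \<open>An automaton running a counter program\<close>

text \<open>Outside resets a cell can only go from \<open>Fuel\<close> to \<open>Mark r\<close> or
  \<open>Spent\<close>, or from \<open>Mark r\<close> to \<open>Spent\<close>. Hence a tape admits
  boundedly many instructions between resets.\<close>

datatype cell = Fuel | Spent | Mark nat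

datatype letter = Cell cell | Ctl prog

type_synonym edge = "prog \<times> instr \<times> prog"

text \<open>\<open>Idle e\<close> reads cells as \<open>Pending e\<close> does, but only
  \<open>Idle e\<close> may begin and end a pass, so a pass can close up only after an end marker.
  \<open>Done e\<close> has rewritten its cell; \<open>Load j\<close> has written \<open>j\<close>
  marks so far.\<close>

datatype state = Err | Idle edge | Pending edge | Done edge | Reset | Load nat | Fill

fun old :: "instr \<Rightarrow> cell" where
  "old (Dec r) = Mark r"
| "old _ = Fuel"

fun new :: "instr \<Rightarrow> cell" where
  "new (Inc r) = Mark r"
| "new _ = Spent"

fun forbidden :: "instr \<Rightarrow> cell set" where
  "forbidden (Test r) = {Mark r}"
| "forbidden _ = {}"

fun scan :: "edge \<Rightarrow> cell \<Rightarrow> state \<times> letter" where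
  "scan (p, i, q) c = (if c \<in> forbidden i then (Err, Cell c)
     else if c = old i then (Done (p, i, q), Cell (new i)) else (Pending (p, i, q), Cell c))"

text \<open>A zero test inspects the whole block, as forbidden cells are detected both before and
  after the rewriting. \<open>Reset\<close> leads to \<open>Load 0\<close>, which writes a mark, so
  the input must be positive. Anything unexpected falls through to the absorbing
  \<open>Err\<close>.\<close>

fun delta :: "prog \<Rightarrow> nat \<Rightarrow> state \<Rightarrow> letter \<Rightarrow> state \<times> letter" where
  "delta P x (Idle e) (Cell c) = scan e c"
| "delta P x (Pending e) (Cell c) = scan e c"
| "delta P x (Done (p, i, q)) (Cell c) =
     (if c \<in> forbidden i then Err else Done (p, i, q), Cell c)"
| "delta P x (Done (p, i, q)) (Ctl p') =
     (if p' = p then (Idle (p, i, q), Ctl q) else (Err, Ctl p'))"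
| "delta P x Reset (Cell c) = (Load 0, Cell Fuel)"
| "delta P x (Load j) (Cell c) = (if Suc j = x then Fill else Load (Suc j), Cell (Mark 0))"
| "delta P x Fill (Cell c) = (Fill, Cell Fuel)"
| "delta P x Fill (Ctl p) = (if p = End then (Reset, Ctl P) else (Err, Ctl p))"
| "delta P x _ a = (Err, a)"

definition edges :: "prog \<Rightarrow> edge set" where
  "edges P = {(p, i, q). p \<in> subprogs P \<and> ctl_step p i q}"

definition fixed_states :: "prog \<Rightarrow> state set" where
  "fixed_states P = {Err, Reset, Fill} \<union> Idle ` edges P \<union> Pending ` edges P \<union> Done ` edges P"

definition letters :: "prog \<Rightarrow> letter set" where
  "letters P = Cell ` ({Fuel, Spent, Mark 0} \<union> (\<lambda>(p, i, q). new i) ` edges P) \<union> Ctl ` subprogs P"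

text \<open>The subset \<open>Q'\<close> of the reduction. Leaving out \<open>Err\<close> excludes
  every pass that fails.\<close>

definition pass_states :: "prog \<Rightarrow> state set" where
  "pass_states P = insert Reset (Idle ` edges P)"

definition automaton :: "prog \<Rightarrow> nat \<Rightarrow> (state, letter) mealy" where
  "automaton P x =
     \<lparr>states = fixed_states P \<union> Load ` {..<x}, alphabet = letters P,
      transition = \<lambda>s a. fst (delta P x s a), production = \<lambda>s a. snd (delta P x s a)\<rparr>"

section \<open>Finiteness and closure of the automaton\<close>

lemma finite_edges: "finite (edges P)"
proof -
  have "finite {(i, q). ctl_step p i q}" for p
  proof (cases p)
    case (Act i q)
    have "{(i, q). ctl_step p i q} \<subseteq> {(i, q)}" unfolding Act by (auto elim: ctl_step_elims)
    then show ?thesis by (rule finite_subset) simp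
  next
    case (Loop b q)
    have "{(i, q). ctl_step p i q} \<subseteq> {(Nop, q), (Nop, b ;; Loop b q)}"
      unfolding Loop by (auto elim: ctl_step_elims)
    then show ?thesis by (rule finite_subset) simp
  next
    case End
    have "{(i, q). ctl_step p i q} = {}" unfolding End by (auto elim: ctl_step_elims)
    then show ?thesis by simp
  qed
  then have "finite (Sigma (subprogs P) (\<lambda>p. {(i, q). ctl_step p i q}))"
    by (intro finite_SigmaI finite_subprogs)
  also have "Sigma (subprogs P) (\<lambda>p. {(i, q). ctl_step p i q}) = edges P"
    by (auto simp: edges_def)
  finally show ?thesis .
qed

lemma finite_fixed_states: "finite (fixed_states P)"
  by (simp add: fixed_states_def finite_edges)

lemma finite_letters: "finite (letters P)"
  by (simp add: letters_def finite_edges finite_subprogs)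

lemma fixed_states_simps [simp]:
  "Err \<in> fixed_states P" "Reset \<in> fixed_states P" "Fill \<in> fixed_states P"
  "Idle e \<in> fixed_states P \<longleftrightarrow> e \<in> edges P" "Pending e \<in> fixed_states P \<longleftrightarrow> e \<in> edges P"
  "Done e \<in> fixed_states P \<longleftrightarrow> e \<in> edges P" "Load j \<notin> fixed_states P"
  by (auto simp: fixed_states_def)

lemma letters_simps [simp]:
  "Cell Fuel \<in> letters P" "Cell Spent \<in> letters P" "Cell (Mark 0) \<in> letters P"
  "Ctl p \<in> letters P \<longleftrightarrow> p \<in> subprogs P"
  by (auto simp: letters_def)

lemma edge_letters: "(p, i, q) \<in> edges P \<Longrightarrow> Cell (new i) \<in> letters P"
  "(p, i, q) \<in> edges P \<Longrightarrow> q \<in> subprogs P"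
proof -
  assume e: "(p, i, q) \<in> edges P"
  then have "new i \<in> (\<lambda>(p, i, q). new i) ` edges P" by force
  then show "Cell (new i) \<in> letters P" by (simp add: letters_def)
  show "q \<in> subprogs P" using e subprogs_closed by (auto simp: edges_def)
qed

lemma delta_fixed:
  assumes "s \<in> fixed_states P" "a \<in> letters P"
  shows "fst (delta P x s a) \<in> insert (Load 0) (fixed_states P)" "snd (delta P x s a) \<in> letters P"
  using assms by (induction P x s a rule: delta.induct)
    (auto simp: self_in_subprogs edge_letters
    split: if_splits)

lemma mealy_automaton_automaton:
  assumes "0 < x"
  shows "mealy_automaton (automaton P x)"
proof -
  have "fst (delta P x s a) \<in> fixed_states P \<union> Load ` {..<x} \<and> snd (delta P x s a) \<in> letters P"
    if s: "s \<in> fixed_states P \<union> Load ` {..<x}" and a: "a \<in> letters P" for s a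
  proof (cases "s \<in> fixed_states P")
    case True
    then show ?thesis using delta_fixed[OF True a, of x] assms by auto
  next
    case False
    then obtain j where "s = Load j" "j < x" using s by blast
    then show ?thesis using a by (cases a) auto
  qed
  moreover have "letters P \<noteq> {}" "fixed_states P \<noteq> {}"
    using letters_simps(1) fixed_states_simps(1) by blast+
  ultimately show ?thesis
    by (simp add: mealy_automaton_def automaton_def finite_fixed_states finite_letters)
qed

section \<open>Configurations and passes over a tape\<close>

lemma state_trans_append: "state_trans M q (v @ w) = state_trans M (state_trans M q v) w"
  by (induction v arbitrary: q) auto

lemma state_output_append:
  "state_output M q (v @ w) = state_output M q v @ state_output M (state_trans M q v) w"
  by (induction v arbitrary: q) auto

fun replace_first :: "'a \<Rightarrow> 'a \<Rightarrow> 'a list \<Rightarrow> 'a list" where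
  "replace_first a b [] = []"
| "replace_first a b (c # w) = (if c = a then b # w else c # replace_first a b w)"

lemma length_replace_first [simp]: "length (replace_first a b w) = length w"
  by (induction w) auto

lemma count_list_replace_first:
  "a \<in> set w \<Longrightarrow> count_list (replace_first a b w) c + (if c = a then 1 else 0) =
     count_list w c + (if c = b then 1 else 0)"
  by (induction w) auto

lemma sum_list_replace_first:
  "a \<in> set w \<Longrightarrow> sum_list (map f (replace_first a b w)) + f a = sum_list (map f w) + (f b :: nat)"
  by (induction w) auto

type_synonym conf = "cell list \<times> prog"

text \<open>The leading \<open>Fuel\<close> is written by \<open>Reset\<close> on the cell where it
  becomes \<open>Load 0\<close>; the \<open>n\<close> cells at the end are spare fuel for the
  run.\<close>

definition init_tape :: "nat \<Rightarrow> nat \<Rightarrow> cell list" where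
  "init_tape x n = Fuel # replicate x (Mark 0) @ replicate n Fuel"

definition edge_steps :: "prog \<Rightarrow> conf rel" where
  "edge_steps P = {((w, p), (replace_first (old i) (new i) w, q)) | w p i q.
     (p, i, q) \<in> edges P \<and> old i \<in> set w \<and> set w \<inter> forbidden i = {}}"

definition reset_steps :: "prog \<Rightarrow> nat \<Rightarrow> conf rel" where
  "reset_steps P x = {((w, End), (init_tape x n, P)) | w n. length w = Suc (x + n)}"

text \<open>A word may contain several end markers and hence several configurations. A pass treats
  the first block independently of what follows, so tracking it alone suffices.\<close>

definition first_block :: "letter list \<Rightarrow> conf \<Rightarrow> bool" where
  "first_block v c \<longleftrightarrow> (\<exists>v'. v = map Cell (fst c) @ Ctl (snd c) # v')"

lemma first_block_cases:
  obtains w where "v = map Cell w" | c where "first_block v c"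
proof (induction v arbitrary: thesis)
  case Nil
  then show ?case by simp
next
  case (Cons a v)
  show ?case
  proof (cases a)
    case (Cell c)
    show ?thesis
    proof (rule Cons.IH)
      fix w assume "v = map Cell w"
      with Cell show ?thesis by (intro Cons.prems(1)[of "c # w"]) simp
    next
      fix d assume "first_block v d"
      with Cell show ?thesis
        by (intro Cons.prems(2)[of "(c # fst d, snd d)"]) (auto simp: first_block_def)
    qed
  next
    case (Ctl p)
    then show ?thesis by (intro Cons.prems(2)[of "([], p)"]) (auto simp: first_block_def)
  qed
qed

lemma first_block_unique:
  assumes "first_block v c" "first_block v d"
  shows "c = d"
proof -
  have "map Cell w @ Ctl p # v = map Cell w' @ Ctl p' # v' \<Longrightarrow> w = w' \<and> p = p'" for w w' p p' v v'
  proof (induction w arbitrary: w')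
    case Nil
    then show ?case by (cases w') auto
  next
    case (Cons a w)
    then show ?case by (cases w') auto
  qed
  then show ?thesis using assms by (metis first_block_def prod.expand)
qed

lemma automaton_simps [simp]:
  "transition (automaton P x) s a = fst (delta P x s a)"
  "production (automaton P x) s a = snd (delta P x s a)"
  by (simp_all add: automaton_def)

lemma state_trans_Err [simp]: "state_trans (automaton P x) Err v = Err"
  by (induction v) auto

lemma Done_cells:
  "state_trans (automaton P x) (Done (p, i, q)) (map Cell w) =
     (if set w \<inter> forbidden i = {} then Done (p, i, q) else Err)"
  "set w \<inter> forbidden i = {} \<Longrightarrow>
     state_output (automaton P x) (Done (p, i, q)) (map Cell w) = map Cell w"
  by (induction w) auto

lemma old_neq_forbidden: "old i \<notin> forbidden i"
  by (cases i) auto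

lemma Pending_cells:
  "state_trans (automaton P x) (Pending (p, i, q)) (map Cell w) =
     (if set w \<inter> forbidden i \<noteq> {} then Err
      else if old i \<in> set w then Done (p, i, q) else Pending (p, i, q))"
  "set w \<inter> forbidden i = {} \<Longrightarrow>
     state_output (automaton P x) (Pending (p, i, q)) (map Cell w) =
       map Cell (replace_first (old i) (new i) w)"
  by (induction w) (auto simp: Done_cells old_neq_forbidden)

lemma Idle_Pending:
  "w \<noteq> [] \<Longrightarrow> state_trans (automaton P x) (Idle e) (map Cell w) =
     state_trans (automaton P x) (Pending e) (map Cell w)"
  "state_output (automaton P x) (Idle e) (map Cell w) =
     state_output (automaton P x) (Pending e) (map Cell w)"
  by (cases w; simp)+

lemma Fill_cells:
  "state_trans (automaton P x) Fill (map Cell w) = Fill"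
  "state_output (automaton P x) Fill (map Cell w) = replicate (length w) (Cell Fuel)"
  by (induction w) auto

lemma Load_cells:
  "j < x \<Longrightarrow> state_trans (automaton P x) (Load j) (map Cell w) =
     (if length w < x - j then Load (j + length w) else Fill)"
  "j < x \<Longrightarrow> x - j \<le> length w \<Longrightarrow> state_output (automaton P x) (Load j) (map Cell w) =
     replicate (x - j) (Cell (Mark 0)) @ replicate (length w - (x - j)) (Cell Fuel)"
proof (induction w arbitrary: j)
  case (Cons c w)
  {
    case 1
    then show ?case using Cons.IH(1)[of "Suc j"] by (auto simp: Fill_cells)
  next
    case 2
    show ?case
    proof (cases "Suc j = x")
      case True
      then have "x - j = 1" by simp
      then show ?thesis using True by (simp add: Fill_cells)
    next
      case False
      then have "x - j = Suc (x - Suc j)" using 2 by simp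
      then show ?thesis using 2 False Cons.IH(2)[of "Suc j"] by simp
    qed
  }
qed auto

text \<open>The first cell moves the automaton out of \<open>Idle\<close> or \<open>Reset\<close>,
  and only an end marker leads back. Hence a tape restored by closed passes contains an end
  marker.\<close>

lemma pass_cells:
  assumes "s \<in> pass_states P" "w \<noteq> []" "0 < x"
  shows "state_trans (automaton P x) s (map Cell w) \<notin> pass_states P"
proof (cases "s = Reset")
  case True
  then show ?thesis using assms(2,3)
    by (cases w) (auto simp: Load_cells pass_states_def)
next
  case False
  then obtain p i q where "s = Idle (p, i, q)" using assms(1) by (auto simp: pass_states_def)
  then show ?thesis using assms(2)
    by (auto simp: Idle_Pending Pending_cells pass_states_def)
qed

lemma pass_first_block:
  assumes s: "s \<in> pass_states P" and x: "0 < x"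
    and loop: "state_trans (automaton P x) s v = s" and block: "first_block v c"
  shows "\<exists>c'. first_block (state_output (automaton P x) s v) c' \<and> (c, c') \<in> edge_steps P \<union> reset_steps P x"
proof -
  let ?M = "automaton P x"
  obtain w p v' where c: "c = (w, p)" and v: "v = map Cell w @ Ctl p # v'"
    using block by (cases c) (auto simp: first_block_def)
  define t where "t = state_trans ?M s (map Cell w)"
  \<comment> \<open>\<open>Err\<close> is absorbing, so a pass that returns to \<open>s\<close>
    cannot have met it in the first block.\<close>
  have not_Err: "fst (delta P x t (Ctl p)) \<noteq> Err"
    using loop s by (auto simp: v state_trans_append t_def[symmetric] pass_states_def)
  have out: "state_output ?M s v = state_output ?M s (map Cell w) @ snd (delta P x t (Ctl p)) #
      state_output ?M (fst (delta P x t (Ctl p))) v'"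
    by (simp add: v state_output_append t_def)
  show ?thesis
  proof (cases "s = Reset")
    case True
    then obtain a w1 where w: "w = a # w1"
      using not_Err by (cases w) (auto simp: t_def)
    have t: "t = (if length w1 < x then Load (length w1) else Fill)"
      using x by (simp add: t_def w True Load_cells)
    \<comment> \<open>A loading state that meets the end marker goes to \<open>Err\<close>, so the
      block has room for the whole input; \<open>Fill\<close> accepts only the marker
      \<open>End\<close>.\<close>
    then have "x \<le> length w1" "t = Fill" "p = End"
      using not_Err by (auto split: if_splits)
    moreover from this obtain n where "length w1 = x + n" by (auto simp: le_iff_add)
    ultimately have "first_block (state_output ?M s v) (init_tape x n, P)"
      using x by (simp add: out first_block_def) (simp add: w True Load_cells init_tape_def)
    moreover have "(c, (init_tape x n, P)) \<in> reset_steps P x"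
      using c w \<open>p = End\<close> \<open>length w1 = x + n\<close> by (auto simp: reset_steps_def)
    ultimately show ?thesis by blast
  next
    case False
    then obtain p' i q where e: "s = Idle (p', i, q)" "(p', i, q) \<in> edges P"
      using s by (auto simp: pass_states_def)
    have "w \<noteq> []" using not_Err e by (auto simp: t_def)
    then have t: "t = (if set w \<inter> forbidden i \<noteq> {} then Err
        else if old i \<in> set w then Done (p', i, q) else Pending (p', i, q))"
      by (simp add: t_def e Idle_Pending Pending_cells)
    then have 1: "set w \<inter> forbidden i = {}" "old i \<in> set w" "t = Done (p', i, q)" "p = p'"
      using not_Err by (auto split: if_splits)
    then have "first_block (state_output ?M s v) (replace_first (old i) (new i) w, q)"
      by (simp add: out first_block_def) (simp add: e Idle_Pending Pending_cells)
    moreover have "(c, (replace_first (old i) (new i) w, q)) \<in> edge_steps P"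
      using 1 e by (auto simp: c edge_steps_def)
    ultimately show ?thesis by blast
  qed
qed

lemma passes_first_block:
  assumes "u \<in> lists (pass_states P)" "0 < x" "word_trans (automaton P x) u v = u" "first_block v c"
  shows "\<exists>c'. first_block (word_output (automaton P x) u v) c' \<and>
    (c, c') \<in> (edge_steps P \<union> reset_steps P x) ^^ length u"
  using assms(1,3)
proof (induction u)
  case Nil
  then show ?case using assms(4) by (intro exI[of _ c]) simp
next
  case (Cons s u)
  then obtain c' where c': "first_block (word_output (automaton P x) u v) c'"
      "(c, c') \<in> (edge_steps P \<union> reset_steps P x) ^^ length u"
    by auto
  have "s \<in> pass_states P" "state_trans (automaton P x) s (word_output (automaton P x) u v) = s"
    using Cons.prems Cons.hyps by simp_all
  from pass_first_block[OF this(1) assms(2) this(2) c'(1)] c'(2)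
  show ?case by auto
qed

text \<open>A potential: every instruction replaces \<open>old i\<close> by a cell of strictly
  higher level, so edge steps alone never close a cycle.\<close>

fun level :: "cell \<Rightarrow> nat" where
  "level Fuel = 0"
| "level (Mark r) = 1"
| "level Spent = 2"

lemma level_old_new: "level (old i) < level (new i)"
  by (cases i) auto

lemma edge_steps_level:
  assumes "((w, p), (w', p')) \<in> (edge_steps P)\<^sup>+"
  shows "sum_list (map level w) < sum_list (map level w')"
proof -
  have level_step: "sum_list (map level (fst c)) < sum_list (map level (fst d))"
    if cd: "(c, d) \<in> edge_steps P" for c d
  proof -
    obtain w i where w: "fst c = w" "fst d = replace_first (old i) (new i) w" "old i \<in> set w"
      using cd by (auto simp: edge_steps_def)
    then show ?thesis using sum_list_replace_first[OF w(3), of level "new i"] level_old_new[of i] by simp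
  qed
  have "sum_list (map level (fst c)) < sum_list (map level (fst d))"
    if "(c, d) \<in> (edge_steps P)\<^sup>+" for c d
    using that
  proof (induction rule: trancl_induct)
    case (base d)
    then show ?case by (rule level_step)
  next
    case (step d e)
    then show ?case using level_step[of d e] by simp
  qed
  from this[OF assms] show ?thesis by simp
qed

section \<open>Tapes as stores of the counter program\<close>

definition store_of :: "cell list \<Rightarrow> store" where
  "store_of w = (\<lambda>r. count_list w (Mark r))"

lemma store_of_init_tape: "store_of (init_tape x n) = input_store x"
proof -
  have "count_list (replicate n a) b = (if a = b then n else 0)" for n and a b :: cell
    by (induction n) auto
  then show ?thesis by (auto simp: store_of_def init_tape_def input_store_def)
qed

lemma count_list_pos_iff: "0 < count_list w a \<longleftrightarrow> a \<in> set w"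
  using count_list_0_iff[of w a] by auto

text \<open>For \<open>Dec r\<close>, the cell \<open>Mark r\<close> to be replaced witnesses a
  nonzero register; for \<open>Test r\<close>, the absence of the forbidden \<open>Mark r\<close> is
  the zero test. \<open>Fuel\<close> and \<open>Spent\<close> are counted by no register.\<close>

lemma exec_replace_first:
  assumes "old i \<in> set w"
  shows "(store_of w, t) \<in> exec i \<longleftrightarrow>
    set w \<inter> forbidden i = {} \<and> t = store_of (replace_first (old i) (new i) w)"
proof -
  have "count_list (replace_first (old i) (new i) w) c =
      count_list w c + (if c = new i then 1 else 0) - (if c = old i then 1 else 0)" for c
    using count_list_replace_first[OF assms, of "new i" c] by simp
  then have "store_of (replace_first (old i) (new i) w) =
      (\<lambda>r. store_of w r + (if Mark r = new i then 1 else 0) - (if Mark r = old i then 1 else 0))"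
    by (simp add: store_of_def)
  also have "\<dots> = (case i of Inc r \<Rightarrow> (store_of w)(r := Suc (store_of w r))
      | Dec r \<Rightarrow> (store_of w)(r := store_of w r - 1) | _ \<Rightarrow> store_of w)"
    by (cases i) auto
  finally show ?thesis
    using assms by (cases i) (auto simp: store_of_def count_list_0_iff count_list_pos_iff)
qed

text \<open>Lack of \<open>Fuel\<close> is the only way a tape can block an instruction that its
  store permits.\<close>

lemma exec_old:
  assumes "(store_of w, t) \<in> exec i" "Fuel \<in> set w"
  shows "old i \<in> set w"
  using assms by (cases i) (auto simp: store_of_def count_list_pos_iff)

lemma edge_steps_run:
  "((w, p), (w', p')) \<in> (edge_steps P)\<^sup>* \<Longrightarrow> run p (store_of w) p' (store_of w')"
proof (induction rule: converse_rtrancl_induct2)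
  case refl
  show ?case by (rule run.refl)
next
  case (step w p w1 p1)
  from step(1) obtain i where "ctl_step p i p1" "old i \<in> set w" "set w \<inter> forbidden i = {}"
      "w1 = replace_first (old i) (new i) w"
    by (auto simp: edge_steps_def edges_def)
  then have "(store_of w, store_of w1) \<in> exec i" by (simp add: exec_replace_first)
  with \<open>ctl_step p i p1\<close> show ?case using step.IH by (rule run.step)
qed

text \<open>Every instruction uses up at most one \<open>Fuel\<close> cell, so the length of the run
  is a sufficient supply. The bound precedes the tape in the quantifiers because the tape is chosen
  to meet it.\<close>

lemma run_edge_steps:
  assumes "run p s p' s'" "p \<in> subprogs P"
  shows "\<exists>n. \<forall>w. store_of w = s \<longrightarrow> n \<le> count_list w Fuel \<longrightarrow>
    (\<exists>w'. ((w, p), (w', p')) \<in> (edge_steps P)\<^sup>*)"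
  using assms
proof (induction rule: run.induct)
  case (refl p s)
  show ?case by blast
next
  case (step p i q s t p' s')
  have e: "(p, i, q) \<in> edges P" and q: "q \<in> subprogs P"
    using step subprogs_closed by (auto simp: edges_def)
  obtain n where n: "\<And>w. store_of w = t \<Longrightarrow> n \<le> count_list w Fuel \<Longrightarrow>
      \<exists>w'. ((w, q), (w', p')) \<in> (edge_steps P)\<^sup>*"
    using step.IH[OF q] by blast
  have "\<exists>w'. ((w, p), (w', p')) \<in> (edge_steps P)\<^sup>*" if w: "store_of w = s" "Suc n \<le> count_list w Fuel" for w
  proof -
    let ?w = "replace_first (old i) (new i) w"
    have "Fuel \<in> set w" using w(2) count_notin by fastforce
    then have old: "old i \<in> set w" using exec_old step.hyps(2) w(1) by blast
    have "(store_of w, t) \<in> exec i" using step.hyps(2) w(1) by simp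
    then have "store_of ?w = t" "set w \<inter> forbidden i = {}"
      unfolding exec_replace_first[OF old] by auto
    moreover have "n \<le> count_list ?w Fuel"
      using count_list_replace_first[OF old, of "new i" Fuel] w(2) by (simp split: if_splits)
    ultimately obtain w' where "((?w, q), (w', p')) \<in> (edge_steps P)\<^sup>*" using n by blast
    moreover have "((w, p), (?w, q)) \<in> edge_steps P"
      using e old \<open>set w \<inter> forbidden i = {}\<close> by (auto simp: edge_steps_def)
    ultimately show ?thesis by (blast intro: converse_rtrancl_into_rtrancl)
  qed
  then show ?case by blast
qed

section \<open>Commuting pairs and halting runs\<close>

definition tape :: "conf \<Rightarrow> letter list" where
  "tape c = map Cell (fst c) @ [Ctl (snd c)]"

text \<open>The word \<open>u\<close> lists the \<open>Idle\<close> states of the edges with the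
  latest pass first, as the head of a state word acts last.\<close>

lemma edge_steps_word:
  "(c, c') \<in> (edge_steps P)\<^sup>* \<Longrightarrow> \<exists>u \<in> lists (pass_states P). length (fst c') = length (fst c) \<and>
     word_trans (automaton P x) u (tape c) = u \<and> word_output (automaton P x) u (tape c) = tape c'"
proof (induction rule: rtrancl_induct)
  case base
  show ?case by (intro bexI[of _ "[]"]) auto
next
  case (step c1 c2)
  then obtain u where u: "u \<in> lists (pass_states P)" "length (fst c1) = length (fst c)"
      "word_trans (automaton P x) u (tape c) = u" "word_output (automaton P x) u (tape c) = tape c1"
    by blast
  from step(2) obtain w p i q where e: "c1 = (w, p)" "c2 = (replace_first (old i) (new i) w, q)"
      "(p, i, q) \<in> edges P" "old i \<in> set w" "set w \<inter> forbidden i = {}"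
    by (auto simp: edge_steps_def)
  then have "w \<noteq> []" by auto
  with e have "state_trans (automaton P x) (Idle (p, i, q)) (tape c1) = Idle (p, i, q)"
      "state_output (automaton P x) (Idle (p, i, q)) (tape c1) = tape c2"
    by (simp_all add: tape_def state_trans_append state_output_append Idle_Pending Pending_cells)
  with u e show ?case
    by (intro bexI[of _ "Idle (p, i, q) # u"]) (auto simp: pass_states_def)
qed

lemma commuting_pair_run:
  assumes "has_commuting_pair_on (automaton P x) (pass_states P)" "0 < x"
  shows "\<exists>s'. run P (input_store x) End s'"
proof -
  let ?M = "automaton P x"
  let ?A = "edge_steps P" and ?B = "reset_steps P x"
  obtain u v where uv: "u \<noteq> []" "v \<noteq> []" "u \<in> lists (pass_states P)"
      "word_trans ?M u v = u" "word_output ?M u v = v"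
    using assms(1) by (auto simp: has_commuting_pair_on_def)
  \<comment> \<open>The last state of \<open>u\<close> acts first, hence on \<open>v\<close> itself.
    It returns to itself, which forces an end marker in \<open>v\<close>.\<close>
  obtain u' s where u': "u = u' @ [s]" using uv(1) by (metis rev_exhaust)
  then have s: "s \<in> pass_states P" "state_trans ?M s v = s"
    using uv(3,4) by (auto simp: word_trans_append)
  obtain c where c: "first_block v c"
    using first_block_cases[of v] pass_cells[OF s(1) _ assms(2)] s uv(2) by (metis map_is_Nil_conv)
  from passes_first_block[OF uv(3) assms(2) uv(4) c] obtain c' where
    "first_block v c'" "(c, c') \<in> (?A \<union> ?B) ^^ length u"
    unfolding uv(5) by blast
  with c first_block_unique have "(c, c) \<in> (?A \<union> ?B) ^^ length u" by metis
  with uv(1) have cycle: "(c, c) \<in> (?A \<union> ?B)\<^sup>+" by (auto simp: trancl_power)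
  \<comment> \<open>A path that does not consist of edge steps alone contains a reset; the potential
    puts the cycle in this case.\<close>
  have "\<exists>y z. (c, y) \<in> (?A \<union> ?B)\<^sup>* \<and> (y, z) \<in> ?B \<and> (z, d) \<in> (?A \<union> ?B)\<^sup>*"
    if "(c, d) \<in> (?A \<union> ?B)\<^sup>+" "(c, d) \<notin> ?A\<^sup>+" for d
    using that
  proof (induction rule: trancl_induct)
    case (base y)
    then show ?case by blast
  next
    case (step d e)
    show ?case
    proof (cases "(d, e) \<in> ?B")
      case True
      then show ?thesis using step(1) by (blast dest: trancl_into_rtrancl)
    next
      case False
      then have "(d, e) \<in> ?A" using step(2) by blast
      then have "(c, d) \<notin> ?A\<^sup>+" using step(4) by (blast intro: trancl_into_trancl)
      then show ?thesis using step.IH step(2) by (blast intro: rtrancl_into_rtrancl)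
    qed
  qed
  moreover have "(c, c) \<notin> ?A\<^sup>+"
    using edge_steps_level[of "fst c" "snd c" "fst c" "snd c"] by auto
  ultimately obtain y z where yz: "(c, y) \<in> (?A \<union> ?B)\<^sup>*" "(y, z) \<in> ?B" "(z, c) \<in> (?A \<union> ?B)\<^sup>*"
    using cycle by blast
  \<comment> \<open>The cycle is rotated to start right after a reset. Up to the next reset, which
    requires the control point \<open>End\<close>, it consists of edge steps only.\<close>
  have "(z, y) \<in> (?A \<union> ?B)\<^sup>*" using yz by (meson rtrancl_trans)
  then have "\<exists>y' \<in> Domain ?B. (z, y') \<in> ?A\<^sup>*"
  proof (induction rule: converse_rtrancl_induct)
    case base
    then show ?case using yz(2) by blast
  next
    case (step z z')
    then show ?case by (blast intro: converse_rtrancl_into_rtrancl)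
  qed
  moreover obtain n where "z = (init_tape x n, P)" using yz(2) by (auto simp: reset_steps_def)
  ultimately obtain w where "((init_tape x n, P), (w, End)) \<in> ?A\<^sup>*"
    by (auto simp: reset_steps_def)
  from edge_steps_run[OF this] show ?thesis unfolding store_of_init_tape by blast
qed

lemma run_commuting_pair:
  assumes "run P (input_store x) End s'" "0 < x"
  shows "has_commuting_pair_on (automaton P x) (pass_states P)"
proof -
  let ?M = "automaton P x"
  from run_edge_steps[OF assms(1) self_in_subprogs]
  obtain n where n: "\<forall>w. store_of w = input_store x \<longrightarrow> n \<le> count_list w Fuel \<longrightarrow>
      (\<exists>w'. ((w, P), (w', End)) \<in> (edge_steps P)\<^sup>*)" ..
  let ?v = "tape (init_tape x n, P)"
  have "n \<le> count_list (replicate n Fuel) Fuel" by (induction n) auto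
  then have "n \<le> count_list (init_tape x n) Fuel" by (simp add: init_tape_def)
  with n store_of_init_tape obtain w where "((init_tape x n, P), (w, End)) \<in> (edge_steps P)\<^sup>*"
    by meson
  from edge_steps_word[OF this, of x] obtain u where u: "u \<in> lists (pass_states P)"
      "length w = length (init_tape x n)" "word_trans ?M u ?v = u" "word_output ?M u ?v = tape (w, End)"
    by auto
  \<comment> \<open>Edge steps keep the length, so the closing \<open>Reset\<close> restores exactly
    the initial tape.\<close>
  obtain a w1 where w: "w = a # w1" "length w1 = x + n"
    using u(2) by (cases w) (auto simp: init_tape_def)
  have "state_trans ?M Reset (tape (w, End)) = Reset" "state_output ?M Reset (tape (w, End)) = ?v"
    using assms(2) w
    by (simp_all add: tape_def init_tape_def state_trans_append state_output_append Load_cells)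
  with u have "word_trans ?M (Reset # u) ?v = Reset # u" "word_output ?M (Reset # u) ?v = ?v"
      "Reset # u \<in> lists (pass_states P)"
    by (auto simp: pass_states_def)
  moreover have "?v \<in> lists (alphabet ?M)"
    using self_in_subprogs by (auto simp: tape_def init_tape_def automaton_def letters_def)
  moreover have "?v \<noteq> []" by (simp add: tape_def)
  ultimately show ?thesis unfolding has_commuting_pair_on_def by blast
qed

section \<open>Computable functions\<close>

definition computable :: "nat \<Rightarrow> (nat list \<Rightarrow> nat) \<Rightarrow> bool" where
  "computable n F \<longleftrightarrow> (\<exists>f. \<forall>xs. length xs = n \<longrightarrow> rec_eval f xs (F xs))"

lemma computable_cong:
  "computable n F \<Longrightarrow> (\<And>xs. length xs = n \<Longrightarrow> F xs = G xs) \<Longrightarrow> computable n G"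
  unfolding computable_def by metis

lemma computable_comp:
  assumes F: "computable (length Gs) F" and Gs: "\<forall>G\<in>set Gs. computable n G"
  shows "computable n (\<lambda>xs. F (map (\<lambda>G. G xs) Gs))"
proof -
  obtain f where f: "\<And>xs. length xs = length Gs \<Longrightarrow> rec_eval f xs (F xs)"
    using F by (auto simp: computable_def)
  from Gs obtain g where g: "\<And>G xs. G \<in> set Gs \<Longrightarrow> length xs = n \<Longrightarrow> rec_eval (g G) xs (G xs)"
    unfolding computable_def by metis
  have "rec_eval (Comp f (map g Gs)) xs (F (map (\<lambda>G. G xs) Gs))" if "length xs = n" for xs
    using that by (intro rec_eval.Comp[where ys = "map (\<lambda>G. G xs) Gs"] f)
      (auto simp: list_all2_conv_all_nth g)
  then show ?thesis unfolding computable_def by blast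
qed

named_theorems computable_intros

lemma computable_nth [computable_intros]: "i < n \<Longrightarrow> computable n (\<lambda>xs. xs ! i)"
  unfolding computable_def using rec_eval.Proj by blast

lemma computable_comp1:
  assumes "computable 1 (\<lambda>xs. F (xs ! 0))" "computable n A"
  shows "computable n (\<lambda>xs. F (A xs))"
  using computable_comp[of "[A]" "\<lambda>xs. F (xs ! 0)"] assms by simp

lemma computable_comp2:
  assumes "computable 2 (\<lambda>xs. F (xs ! 0) (xs ! 1))" "computable n A" "computable n B"
  shows "computable n (\<lambda>xs. F (A xs) (B xs))"
  using computable_comp[of "[A, B]" "\<lambda>xs. F (xs ! 0) (xs ! 1)"] assms by (simp add: numeral_2_eq_2)

lemma computable_Suc [computable_intros]: "computable n A \<Longrightarrow> computable n (\<lambda>xs. Suc (A xs))"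
proof (rule computable_comp1[where F = Suc])
  have "rec_eval Succ xs (Suc (xs ! 0))" if "length xs = 1" for xs
    using that rec_eval.Succ by (auto simp: length_Suc_conv)
  then show "computable 1 (\<lambda>xs. Suc (xs ! 0))" unfolding computable_def by blast
qed

lemma computable_const [computable_intros]: "computable n (\<lambda>_. c)"
proof (induction c)
  case 0
  show ?case unfolding computable_def using rec_eval.Zero by blast
next
  case (Suc c)
  then show ?case by (rule computable_Suc)
qed

lemma computable_rec:
  assumes "computable 1 (\<lambda>xs. F (xs ! 0))" "computable 3 (\<lambda>xs. G (xs ! 0) (xs ! 1) (xs ! 2))"
    and "\<And>p. R 0 p = F p" "\<And>m p. R (Suc m) p = G m (R m p) p"
    and "computable n A" "computable n B"
  shows "computable n (\<lambda>xs. R (A xs) (B xs))"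
proof (rule computable_comp2[OF _ assms(5,6)])
  obtain f where f: "\<And>xs. length xs = 1 \<Longrightarrow> rec_eval f xs (F (xs ! 0))"
    using assms(1) unfolding computable_def by blast
  obtain g where g: "\<And>xs. length xs = 3 \<Longrightarrow> rec_eval g xs (G (xs ! 0) (xs ! 1) (xs ! 2))"
    using assms(2) unfolding computable_def by blast
  have "rec_eval (PrimRec f g) [m, p] (R m p)" for m p
  proof (induction m)
    case 0
    then show ?case using rec_eval.PrimRec_0[OF f[of "[p]"]] assms(3) by simp
  next
    case (Suc m)
    then show ?case using rec_eval.PrimRec_Suc[OF Suc g[of "[m, R m p, p]"]] assms(4) by simp
  qed
  then have "rec_eval (PrimRec f g) xs (R (xs ! 0) (xs ! 1))" if "length xs = 2" for xs
    using that by (auto simp: length_Suc_conv numeral_2_eq_2)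
  then show "computable 2 (\<lambda>xs. R (xs ! 0) (xs ! 1))" unfolding computable_def by blast
qed

section \<open>Arithmetic and coding functions\<close>

lemma computable_add [computable_intros]:
  "computable n A \<Longrightarrow> computable n B \<Longrightarrow> computable n (\<lambda>xs. A xs + B xs)"
  by (rule computable_rec[where R = "\<lambda>m p. m + p" and F = "\<lambda>p. p" and G = "\<lambda>m y p. Suc y"])
    (auto intro!: computable_intros)

lemma computable_mult [computable_intros]:
  "computable n A \<Longrightarrow> computable n B \<Longrightarrow> computable n (\<lambda>xs. A xs * B xs)"
  by (rule computable_rec[where R = "\<lambda>m p. m * p" and F = "\<lambda>p. 0" and G = "\<lambda>m y p. p + y"])
    (auto intro!: computable_intros)

lemma computable_pred:
  "computable n A \<Longrightarrow> computable n (\<lambda>xs. A xs - Suc 0)"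
  by (rule computable_rec[where R = "\<lambda>m p. m - Suc 0" and F = "\<lambda>p. 0" and G = "\<lambda>m y p. m" and B = "\<lambda>_. 0"])
    (auto intro!: computable_intros)

lemma computable_diff [computable_intros]:
  "computable n A \<Longrightarrow> computable n B \<Longrightarrow> computable n (\<lambda>xs. A xs - B xs)"
  by (rule computable_rec[where R = "\<lambda>m p. p - m" and F = "\<lambda>p. p" and G = "\<lambda>m y p. y - 1"])
    (auto intro!: computable_intros computable_pred)

lemma computable_triangle [computable_intros]:
  "computable n A \<Longrightarrow> computable n (\<lambda>xs. triangle (A xs))"
  by (rule computable_rec[where R = "\<lambda>m p. triangle m" and F = "\<lambda>p. 0" and G = "\<lambda>m y p. y + Suc m" and B = "\<lambda>_. 0"])
    (auto intro!: computable_intros)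

lemma computable_prod_encode [computable_intros]:
  "computable n A \<Longrightarrow> computable n B \<Longrightarrow> computable n (\<lambda>xs. prod_encode (A xs, B xs))"
  unfolding prod_encode_def prod.case by (intro computable_intros)

lemma computable_if0:
  assumes "computable n A" "computable n B" "computable n C"
  shows "computable n (\<lambda>xs. if A xs = 0 then B xs else C xs)"
proof (rule computable_cong)
  \<comment> \<open>With truncated subtraction, \<open>1 - A xs\<close> is the indicator of
    \<open>A xs = 0\<close>.\<close>
  show "computable n (\<lambda>xs. B xs * (1 - A xs) + C xs * (1 - (1 - A xs)))"
    by (intro computable_intros assms)
qed auto

lemma computable_if_less [computable_intros]:
  assumes "computable n A" "computable n B" "computable n C" "computable n D"
  shows "computable n (\<lambda>xs. if A xs < B xs then C xs else D xs)"
proof (rule computable_cong)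
  show "computable n (\<lambda>xs. if Suc (A xs) - B xs = 0 then C xs else D xs)"
    by (intro computable_if0 computable_intros assms)
qed auto

lemma computable_if_eq [computable_intros]:
  assumes "computable n A" "computable n B" "computable n C" "computable n D"
  shows "computable n (\<lambda>xs. if A xs = B xs then C xs else D xs)"
proof (rule computable_cong)
  show "computable n (\<lambda>xs. if (A xs - B xs) + (B xs - A xs) = 0 then C xs else D xs)"
    by (intro computable_if0 computable_intros assms)
qed auto

lemma computable_Least:
  assumes F: "computable (Suc n) F" and ex: "\<And>xs. length xs = n \<Longrightarrow> \<exists>m. F (m # xs) = 0"
  shows "computable n (\<lambda>xs. LEAST m. F (m # xs) = 0)"
proof -
  obtain f where f: "\<And>xs. length xs = Suc n \<Longrightarrow> rec_eval f xs (F xs)"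
    using F by (auto simp: computable_def)
  have "rec_eval (Mu f) xs (LEAST m. F (m # xs) = 0)" if "length xs = n" for xs
  proof (rule rec_eval.Mu)
    show "rec_eval f ((LEAST m. F (m # xs) = 0) # xs) 0"
      using f[of "(LEAST m. F (m # xs) = 0) # xs"] LeastI_ex[OF ex[OF that]] that by simp
    show "\<forall>m<LEAST m. F (m # xs) = 0. \<exists>y. rec_eval f (m # xs) (Suc y)"
    proof (intro allI impI)
      fix m assume "m < (LEAST m. F (m # xs) = 0)"
      then have "F (m # xs) \<noteq> 0" by (rule not_less_Least)
      then obtain y where "F (m # xs) = Suc y" using not0_implies_Suc by blast
      then show "\<exists>y. rec_eval f (m # xs) (Suc y)" using f[of "m # xs"] that by auto
    qed
  qed
  then show ?thesis unfolding computable_def by blast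
qed

lemma computable_div [computable_intros]:
  assumes "computable n A" "computable n B"
  shows "computable n (\<lambda>xs. A xs div B xs)"
proof (rule computable_comp2[OF _ assms])
  \<comment> \<open>For \<open>b > 0\<close>, \<open>a div b\<close> is the least \<open>m\<close>
    with \<open>Suc a \<le> Suc m * b\<close>. The extra factor \<open>b\<close> lets the search end
    for \<open>b = 0\<close> as well, where the result is set to 0.\<close>
  have "computable 2 (\<lambda>xs. if xs ! 1 = 0 then 0 else LEAST m. (\<lambda>ys. (Suc (ys ! 1) - Suc (ys ! 0) * (ys ! 2)) * (ys ! 2)) (m # xs) = 0)"
  proof (intro computable_if0 computable_Least computable_intros)
    fix xs :: "nat list" 
    have "Suc a - Suc a * b = 0 \<or> b = 0" for a b :: nat by (cases b) auto
    then show "\<exists>m. (Suc ((m # xs) ! 1) - Suc ((m # xs) ! 0) * (m # xs) ! 2) * (m # xs) ! 2 = 0"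
      by (intro exI[of _ "xs ! 0"]) (auto simp: numeral_2_eq_2)
  qed auto
  then show "computable 2 (\<lambda>xs. xs ! 0 div xs ! 1)"
  proof (rule computable_cong)
    fix xs :: "nat list"
    have "(LEAST m. Suc a - Suc m * b = 0) = a div b" if "b > 0" for a b :: nat
    proof (rule Least_equality)
      show "Suc a - Suc (a div b) * b = 0"
        using that by (metis diff_is_0_eq' dividend_less_div_times less_eq_Suc_le mult_Suc add.commute mult.commute)
      show "a div b \<le> m" if "Suc a - Suc m * b = 0" for m
        using that \<open>b > 0\<close> by (metis Suc_le_eq diff_is_0_eq less_Suc_eq_le less_mult_imp_div_less)
    qed
    then show "(if xs ! 1 = 0 then 0 else LEAST m. (\<lambda>ys. (Suc (ys ! 1) - Suc (ys ! 0) * (ys ! 2)) * (ys ! 2)) (m # xs) = 0)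
       = xs ! 0 div xs ! 1"
      by (auto simp: numeral_2_eq_2)
  qed
qed

lemma computable_mod [computable_intros]:
  assumes "computable n A" "computable n B"
  shows "computable n (\<lambda>xs. A xs mod B xs)"
  unfolding minus_div_mult_eq_mod[symmetric] by (intro computable_intros assms)

text \<open>Since \<open>prod_encode (a, b) = triangle (a + b) + a\<close>, the least
  \<open>s\<close> with \<open>c < triangle (Suc s)\<close> is the diagonal \<open>a + b\<close>,
  from which both components can be read off.\<close>

lemma prod_decode_Least:
  defines "d \<equiv> \<lambda>c. LEAST s. Suc c - triangle (Suc s) = 0"
  shows "fst (prod_decode c) = c - triangle (d c)" "snd (prod_decode c) = d c - (c - triangle (d c))"
proof -
  obtain a b where c: "c = prod_encode (a, b)" by (metis prod_decode_inverse surj_pair)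
  have mono: "triangle m \<le> triangle n" if "m \<le> n" for m n
    using that by (induction rule: dec_induct) auto
  have "d c = a + b" unfolding d_def
  proof (rule Least_equality)
    show "a + b \<le> s" if "Suc c - triangle (Suc s) = 0" for s
    proof (rule ccontr)
      assume "\<not> a + b \<le> s"
      then have "triangle (Suc s) \<le> triangle (a + b)" by (intro mono) simp
      then show False using that by (simp add: c prod_encode_def)
    qed
  qed (simp add: c prod_encode_def)
  then show "fst (prod_decode c) = c - triangle (d c)" "snd (prod_decode c) = d c - (c - triangle (d c))"
    by (simp_all add: c, simp_all add: prod_encode_def)
qed

lemma computable_prod_decode [computable_intros]:
  assumes "computable n A"
  shows "computable n (\<lambda>xs. fst (prod_decode (A xs)))" "computable n (\<lambda>xs. snd (prod_decode (A xs)))"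
proof -
  have "computable 1 (\<lambda>xs. LEAST s. (\<lambda>ys. Suc (ys ! 1) - triangle (Suc (ys ! 0))) (s # xs) = 0)"
  proof (intro computable_Least computable_intros)
    fix xs :: "nat list"
    have "Suc a - triangle (Suc a) = 0" for a by (induction a) auto
    then show "\<exists>m. Suc ((m # xs) ! 1) - triangle (Suc ((m # xs) ! 0)) = 0"
      by (intro exI[of _ "xs ! 0"]) simp
  qed auto
  then have "computable 1 (\<lambda>xs. LEAST s. Suc (xs ! 0) - triangle (Suc s) = 0)"
    by (rule computable_cong) simp
  from computable_comp1[OF this assms]
  show "computable n (\<lambda>xs. fst (prod_decode (A xs)))" "computable n (\<lambda>xs. snd (prod_decode (A xs)))"
    unfolding prod_decode_Least by (intro computable_intros assms; assumption)+
qed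

text \<open>\<open>list_encode\<close> maps \<open>x # xs\<close> to
  \<open>Suc (prod_encode (x, list_encode xs))\<close>, hence the decrement before decoding.\<close>

definition hd_code :: "nat \<Rightarrow> nat" where
  "hd_code c = fst (prod_decode (c - 1))"

definition tl_code :: "nat \<Rightarrow> nat" where
  "tl_code c = snd (prod_decode (c - 1))"

definition nth_code :: "nat \<Rightarrow> nat \<Rightarrow> nat" where
  "nth_code c i = hd_code ((tl_code ^^ i) c)"

lemma nth_code_list_encode: "i < length xs \<Longrightarrow> nth_code (list_encode xs) i = xs ! i"
proof (induction i arbitrary: xs)
  case 0
  then show ?case by (cases xs) (auto simp: nth_code_def hd_code_def)
next
  case (Suc i)
  then show ?case by (cases xs) (auto simp: nth_code_def tl_code_def funpow_swap1)
qed

lemma computable_nth_code [computable_intros]: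
  assumes "computable n A" "computable n B"
  shows "computable n (\<lambda>xs. nth_code (A xs) (B xs))"
proof -
  have "computable n (\<lambda>xs. (tl_code ^^ B xs) (A xs))"
    by (rule computable_rec[where R = "\<lambda>i. tl_code ^^ i" and F = "\<lambda>p. p" and G = "\<lambda>m y p. tl_code y"])
      (auto simp: tl_code_def intro!: computable_intros assms)
  then show ?thesis unfolding nth_code_def hd_code_def by (intro computable_intros)
qed

lemma computable_map_upt:
  assumes g: "computable 2 (\<lambda>xs. g (xs ! 0) (xs ! 1))" and N: "computable 1 (\<lambda>xs. N (xs ! 0))"
    and A: "computable n A"
  shows "computable n (\<lambda>xs. list_encode (map (g (A xs)) [0..<N (A xs)]))"
proof -
  \<comment> \<open>\<open>R m p\<close> is to be the code of the last \<open>m\<close> entries: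
    list codes are built from the end.\<close>
  define R where "R = rec_nat (\<lambda>p. 0) (\<lambda>m r p. Suc (prod_encode (g p (N p - Suc m), r p)))"
  have "m \<le> N p \<Longrightarrow> R m p = list_encode (map (g p) [N p - m..<N p])" for m p
  proof (induction m)
    case 0
    then show ?case by (simp add: R_def)
  next
    case (Suc m)
    then have "[N p - Suc m..<N p] = (N p - Suc m) # [N p - m..<N p]"
      by (subst upt_conv_Cons) (auto simp: Suc_diff_Suc)
    then show ?case using Suc by (simp add: R_def)
  qed
  then have "R (N p) p = list_encode (map (g p) [0..<N p])" for p by simp
  moreover have "computable n (\<lambda>xs. R (N (A xs)) (A xs))"
    by (rule computable_rec[where R = R and F = "\<lambda>p. 0" and
          G = "\<lambda>m y p. Suc (prod_encode (g p (N p - Suc m), y))"])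
      (auto simp: R_def intro!: computable_intros computable_comp2[OF g] computable_comp1[OF N] A)
  ultimately show ?thesis by simp
qed

section \<open>The reduction\<close>

text \<open>Instances name states and letters by natural numbers; commuting pairs are carried over
  to such a renamed automaton.\<close>

locale mealy_iso =
  fixes M :: "('q, 'a) mealy" and N :: "('r, 'b) mealy" and f :: "'q \<Rightarrow> 'r" and g :: "'a \<Rightarrow> 'b"
  assumes automaton_M: "mealy_automaton M"
    and bij_f: "bij_betw f (states M) (states N)" and bij_g: "bij_betw g (alphabet M) (alphabet N)"
    and transition_iso: "\<And>q a. q \<in> states M \<Longrightarrow> a \<in> alphabet M \<Longrightarrow>
      transition N (f q) (g a) = f (transition M q a)"
    and production_iso: "\<And>q a. q \<in> states M \<Longrightarrow> a \<in> alphabet M \<Longrightarrow>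
      production N (f q) (g a) = g (production M q a)"
begin

lemma closed:
  "q \<in> states M \<Longrightarrow> a \<in> alphabet M \<Longrightarrow> transition M q a \<in> states M"
  "q \<in> states M \<Longrightarrow> a \<in> alphabet M \<Longrightarrow> production M q a \<in> alphabet M"
  using automaton_M by (auto simp: mealy_automaton_def)

lemma mealy_automaton_N: "mealy_automaton N"
proof -
  have "states N = f ` states M" "alphabet N = g ` alphabet M"
    using bij_f bij_g by (simp_all add: bij_betw_def)
  then show ?thesis
    using automaton_M by (auto simp: mealy_automaton_def transition_iso production_iso)
qed

lemma state_iso:
  "q \<in> states M \<Longrightarrow> v \<in> lists (alphabet M) \<Longrightarrow>
     state_trans N (f q) (map g v) = f (state_trans M q v) \<and>
     state_output N (f q) (map g v) = map g (state_output M q v) \<and>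
     state_trans M q v \<in> states M \<and> state_output M q v \<in> lists (alphabet M)"
  by (induction v arbitrary: q) (auto simp: transition_iso production_iso closed)

lemma word_iso:
  "u \<in> lists (states M) \<Longrightarrow> v \<in> lists (alphabet M) \<Longrightarrow>
     word_trans N (map f u) (map g v) = map f (word_trans M u v) \<and>
     word_output N (map f u) (map g v) = map g (word_output M u v) \<and>
     word_trans M u v \<in> lists (states M) \<and> word_output M u v \<in> lists (alphabet M)"
  by (induction u) (auto simp: state_iso)

lemma has_commuting_pair_on_iso:
  assumes "Q \<subseteq> states M"
  shows "has_commuting_pair_on N (f ` Q) \<longleftrightarrow> has_commuting_pair_on M Q"
proof -
  have inj: "inj_on f (states M)" "inj_on g (alphabet M)" and img: "g ` alphabet M = alphabet N"
    using bij_f bij_g by (auto simp: bij_betw_def)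
  have *: "word_trans N (map f u) (map g v) = map f u \<longleftrightarrow> word_trans M u v = u"
    "word_output N (map f u) (map g v) = map g v \<longleftrightarrow> word_output M u v = v"
    if "u \<in> lists (states M)" "v \<in> lists (alphabet M)" for u v
    using word_iso[OF that] that inj_on_map_lists[OF inj(1)] inj_on_map_lists[OF inj(2)]
    by (metis inj_on_eq_iff)+
  show ?thesis
  proof
    assume "has_commuting_pair_on M Q"
    then obtain u v where uv: "u \<noteq> []" "v \<noteq> []" "u \<in> lists Q" "v \<in> lists (alphabet M)"
        "word_trans M u v = u" "word_output M u v = v"
      unfolding has_commuting_pair_on_def by blast
    moreover from uv have "u \<in> lists (states M)" using assms by auto
    moreover have "map f u \<in> lists (f ` Q)" "map g v \<in> lists (alphabet N)"
      unfolding img[symmetric] lists_image using uv by blast+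
    ultimately show "has_commuting_pair_on N (f ` Q)"
      unfolding has_commuting_pair_on_def using *
      by (intro exI[of _ "map f u"] exI[of _ "map g v"]) auto
  next
    assume "has_commuting_pair_on N (f ` Q)"
    then obtain u' v' where uv: "u' \<noteq> []" "v' \<noteq> []" "u' \<in> lists (f ` Q)" "v' \<in> lists (alphabet N)"
        "word_trans N u' v' = u'" "word_output N u' v' = v'"
      unfolding has_commuting_pair_on_def by blast
    obtain u where u: "u \<in> lists Q" "u' = map f u" using uv(3) by (auto simp: lists_image)
    obtain v where v: "v \<in> lists (alphabet M)" "v' = map g v"
      using uv(4) unfolding img[symmetric] by (auto simp: lists_image)
    have "u \<in> lists (states M)" using u assms by auto
    then show "has_commuting_pair_on M Q"
      unfolding has_commuting_pair_on_def using * uv u v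
      by (intro exI[of _ u] exI[of _ v]) auto
  qed
qed

end

text \<open>The lexicographic order of the transition table is row-major, so the table can be
  generated from the single index \<open>q * k + a\<close>.\<close>

lemma map_product_upt:
  assumes "\<And>q a. q < n \<Longrightarrow> a < k \<Longrightarrow> h q a = t (q * k + a)"
  shows "map (\<lambda>(q, a). h q a) (List.product [0..<n] [0..<k]) = map t [0..<n * k]"
  using assms
proof (induction n)
  case (Suc n)
  have "List.product (xs @ [q]) ys = List.product xs ys @ map (Pair q) ys" for xs ys :: "nat list" and q
    by (induction xs) auto
  moreover have "[0..<Suc n * k] = [0..<n * k] @ map (\<lambda>a. n * k + a) [0..<k]"
    using map_add_upt[of "n * k" k] upt_add_eq_append[of 0 "n * k" k] by (simp add: add.commute)
  ultimately show ?case using Suc by simp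
qed simp

text \<open>
  The entries of a program code are, in this order: the number of letters, the number of fixed
  states, the codes of the alphabet and of the set of chosen states, the table of the fixed states,
  a list indexed by letters, the number of \<open>Fill\<close> and the number of \<open>Cell (Mark 0)\<close>. The list
  gives \<open>0\<close> for cells, and for an end marker the successor of the table entry shared by all loading
  states. The loading states are numbered after the fixed ones, and the input is the code itself.
\<close>

definition table :: "nat \<Rightarrow> nat \<Rightarrow> nat" where
  "table c i =
     (if i < nth_code c 1 * nth_code c 0 then nth_code (nth_code c 4) i
      else if nth_code (nth_code c 5) (i mod nth_code c 0) = 0 then
        prod_encode (if Suc (i div nth_code c 0) = nth_code c 1 + c then nth_code c 6
          else Suc (i div nth_code c 0), nth_code c 7)
      else nth_code (nth_code c 5) (i mod nth_code c 0) - 1)"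

definition instance_code :: "nat \<Rightarrow> nat" where
  "instance_code c = list_encode
     [list_encode [0..<nth_code c 1 + c], nth_code c 2, nth_code c 3,
      list_encode (map (table c) [0..<(nth_code c 1 + c) * nth_code c 0])]"

lemma computable_instance_code: "computable 1 (\<lambda>xs. instance_code (xs ! 0))"
proof -
  have 1: "computable 1 (\<lambda>xs. list_encode (map ((\<lambda>c i. i) (xs ! 0)) [0..<nth_code (xs ! 0) 1 + xs ! 0]))"
    by (rule computable_map_upt) (intro computable_intros; simp)+
  have 2: "computable 1 (\<lambda>xs. list_encode (map (table (xs ! 0))
      [0..<(nth_code (xs ! 0) 1 + xs ! 0) * nth_code (xs ! 0) 0]))"
  proof (rule computable_map_upt)
    show "computable 2 (\<lambda>xs. table (xs ! 0) (xs ! 1))"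
      unfolding table_def by (intro computable_intros computable_if0) simp_all
  qed (intro computable_intros; simp)+
  show ?thesis
    unfolding instance_code_def list_encode.simps
    by (intro computable_intros 1[unfolded map_ident] 2) simp_all
qed

text \<open>The input enters only the transitions of the loading states. So the rows of the fixed
  states can be put into the code before the input, which will be that very code, is known.\<close>

lemma delta_fixed_eq: "s \<in> fixed_states P \<Longrightarrow> delta P x s a = delta P y s a"
  by (cases s; cases a) auto

text \<open>Self-reference is possible because no entry of the code depends on the input: the
  finished code can itself be taken as the input.\<close>

lemma instance_of_program:
  obtains c M Q where "(M, Q) \<in> commuting_pair_instances" "encode_instance (M, Q) = instance_code c"
    "0 < c" "has_commuting_pair_on M Q \<longleftrightarrow> has_commuting_pair_on (automaton P c) (pass_states P)"
proof -
  define m where "m = card (fixed_states P)"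
  define k where "k = card (letters P)"
  obtain f where f: "bij_betw f (fixed_states P) {0..<m}"
    unfolding m_def using ex_bij_betw_finite_nat[OF finite_fixed_states] by blast
  obtain g where g: "bij_betw g (letters P) {0..<k}"
    unfolding k_def using ex_bij_betw_finite_nat[OF finite_letters] by blast
  define f' where "f' = inv_into (fixed_states P) f"
  define g' where "g' = inv_into (letters P) g"
  define num where "num = (\<lambda>s. case s of Load j \<Rightarrow> m + j | _ \<Rightarrow> f s)"
  define entry where "entry = (\<lambda>d. prod_encode (num (fst d), g (snd d)))"
  \<comment> \<open>The input 1 is a placeholder, by \<open>delta_fixed_eq\<close>; the number of
    \<open>Load 0\<close> is \<open>m\<close> for every input.\<close>
  define T where "T = map (\<lambda>i. entry (delta P 1 (f' (i div k)) (g' (i mod k)))) [0..<m * k]"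
  define R where "R = map (\<lambda>a. case g' a of Cell _ \<Rightarrow> 0 | _ \<Rightarrow> Suc (entry (Err, g' a))) [0..<k]"
  define Q where "Q = num ` pass_states P"
  define cs where "cs = [k, m, list_encode [0..<k], list_encode (sorted_list_of_set Q),
    list_encode T, list_encode R, num Fill, g (Cell (Mark 0))]"
  define c where "c = list_encode cs"
  define M where "M = \<lparr>states = {0..<m + c}, alphabet = {0..<k},
    transition = (\<lambda>q a. fst (prod_decode (table c (q * k + a)))),
    production = (\<lambda>q a. snd (prod_decode (table c (q * k + a))))\<rparr>"
  have c: "0 < c" by (simp add: c_def cs_def)
  have nth: "nth_code c i = cs ! i" if "i < 8" for i
    unfolding c_def using that by (intro nth_code_list_encode) (simp add: cs_def)
  have cs: "nth_code c 0 = k" "nth_code c 1 = m" "nth_code c 2 = list_encode [0..<k]"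
    "nth_code c 3 = list_encode (sorted_list_of_set Q)" "nth_code c 4 = list_encode T"
    "nth_code c 5 = list_encode R" "nth_code c 6 = num Fill" "nth_code c 7 = g (Cell (Mark 0))"
    by (subst nth; simp add: cs_def)+
  have num_fixed: "num s = f s" "num s < m" "f' (num s) = s" if "s \<in> fixed_states P" for s
  proof -
    show 1: "num s = f s" using that by (auto simp: num_def split: state.split)
    show "num s < m" "f' (num s) = s"
      unfolding 1 f'_def using that f by (auto simp: bij_betw_def)
  qed
  have num_Load: "num (Load j) = m + j" for j by (simp add: num_def)
  have letter: "g a < k" "g' (g a) = a" if "a \<in> letters P" for a
    unfolding g'_def using that g by (auto simp: bij_betw_def)
  have table: "table c (num s * k + g a) = entry (delta P c s a)"
    if s: "s \<in> fixed_states P \<union> Load ` {..<c}" and a: "a \<in> letters P" for s a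
  proof (cases "s \<in> fixed_states P")
    case True
    have "num s * k + g a < Suc (num s) * k" using letter[OF a] by simp
    also have "\<dots> \<le> m * k" using num_fixed[OF True] by (intro mult_right_mono) auto
    finally have i: "num s * k + g a < m * k" .
    then have "table c (num s * k + g a) = T ! (num s * k + g a)"
      unfolding table_def cs by (simp add: nth_code_list_encode T_def)
    also have "\<dots> = entry (delta P 1 s a)"
      using i letter[OF a] num_fixed[OF True] by (simp add: T_def)
    finally show ?thesis using delta_fixed_eq[OF True] by metis
  next
    case False
    then obtain j where j: "s = Load j" "j < c" using s by auto
    have "num s * k + g a = g a + (m + j) * k" by (simp add: j num_Load)
    then have i: "(num s * k + g a) div k = m + j" "(num s * k + g a) mod k = g a"
      using letter(1)[OF a] by (simp_all only: div_mult_self1 mod_mult_self1) simp_all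
    have "\<not> num s * k + g a < m * k" by (simp add: j num_Load add_mult_distrib)
    note i = i this
    have R: "nth_code (list_encode R) (g a) = (case a of Cell _ \<Rightarrow> 0 | _ \<Rightarrow> Suc (entry (Err, a)))"
      using letter[OF a] by (subst nth_code_list_encode) (auto simp: R_def split: letter.split)
    \<comment> \<open>Here the comparison with the number of states in \<open>table\<close> amounts
      to \<open>Suc j = c\<close>, the condition under which the last mark leads to
      \<open>Fill\<close>.\<close>
    show ?thesis
      unfolding table_def cs using i R j by (cases a) (auto simp: entry_def num_Load)
  qed
  have iso: "mealy_iso (automaton P c) M num g"
  proof
    show "mealy_automaton (automaton P c)" using c by (rule mealy_automaton_automaton)
    have "bij_betw num (fixed_states P) {0..<m}"
      using f by (rule bij_betw_cong[THEN iffD1, rotated]) (simp add: num_fixed)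
    moreover have "bij_betw num (Load ` {..<c}) {m..<m + c}"
      by (rule bij_betw_byWitness[where f' = "\<lambda>n. Load (n - m)"]) (auto simp: num_Load)
    ultimately have "bij_betw num (fixed_states P \<union> Load ` {..<c}) ({0..<m} \<union> {m..<m + c})"
      by (rule bij_betw_combine) auto
    also have "{0..<m} \<union> {m..<m + c} = {0..<m + c}" by auto
    finally show "bij_betw num (states (automaton P c)) (states M)"
      by (simp add: automaton_def M_def)
    show "bij_betw g (alphabet (automaton P c)) (alphabet M)"
      using g by (simp add: automaton_def M_def)
  qed (simp_all add: M_def table entry_def, simp_all add: automaton_def table entry_def)
  then interpret mealy_iso "automaton P c" M num g .
  have sub: "pass_states P \<subseteq> states (automaton P c)"
    by (auto simp: pass_states_def automaton_def)
  have Err: "Err \<in> states (automaton P c)" "Err \<notin> pass_states P"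
    by (auto simp: pass_states_def automaton_def)
  have "Q \<subset> states M"
  proof
    show "Q \<subseteq> states M" using sub bij_f by (auto simp: Q_def bij_betw_def)
    \<comment> \<open>The error state witnesses that the chosen subset is proper.\<close>
    have "num Err \<notin> Q" unfolding Q_def
      using Err sub bij_f by (auto simp: bij_betw_def inj_on_def)
    then show "Q \<noteq> states M" using Err bij_f by (auto simp: bij_betw_def)
  qed
  then have "(M, Q) \<in> commuting_pair_instances"
    using mealy_automaton_N by (simp add: commuting_pair_instances_def)
  moreover have "encode_instance (M, Q) = instance_code c"
  proof -
    have "map (\<lambda>(q, a). prod_encode (transition M q a, production M q a))
        (List.product [0..<m + c] [0..<k]) = map (table c) [0..<(m + c) * k]"
      by (rule map_product_upt) (simp add: M_def)
    moreover have "states M = {0..<m + c}" "alphabet M = {0..<k}" by (simp_all add: M_def)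
    ultimately show ?thesis unfolding instance_code_def cs by simp
  qed
  moreover have "has_commuting_pair_on M Q \<longleftrightarrow> has_commuting_pair_on (automaton P c) (pass_states P)"
    unfolding Q_def by (rule has_commuting_pair_on_iso[OF sub])
  ultimately show ?thesis using c that by blast
qed

section \<open>The diagonal argument\<close>

theorem theorem6p5:
  "\<not> decidable commuting_pair_instances encode_instance
       (\<lambda>(M, Q'). has_commuting_pair_on M Q')"
proof
  assume "decidable commuting_pair_instances encode_instance (\<lambda>(M, Q'). has_commuting_pair_on M Q')"
  then obtain d where d: "\<And>M Q. (M, Q) \<in> commuting_pair_instances \<Longrightarrow>
      rec_eval d [encode_instance (M, Q)] (if has_commuting_pair_on M Q then 1 else 0)"
    unfolding decidable_def by fastforce
  obtain h where h: "\<And>c. rec_eval h [c] (instance_code c)"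
    using computable_instance_code unfolding computable_def
    by (metis One_nat_def length_Cons list.size(3) nth_Cons_0)
  \<comment> \<open>\<open>Proj 1\<close> skips the search variable of \<open>Mu\<close>. So
    \<open>Mu e\<close> halts with value 0 if the answer for the instance is no, and diverges if it
    is yes.\<close>
  define e where "e = Comp d [Comp h [Proj 1]]"
  define P where "P = compile (Mu e) [0] 1 2"
  \<comment> \<open>The instance coded by \<open>c\<close> asks whether \<open>P\<close> halts on
    input \<open>c\<close>, while \<open>P\<close> halts there exactly if the decision procedure
    answers no.\<close>
  obtain c M Q where c: "(M, Q) \<in> commuting_pair_instances" "encode_instance (M, Q) = instance_code c"
      "0 < c" "has_commuting_pair_on M Q \<longleftrightarrow> has_commuting_pair_on (automaton P c) (pass_states P)"
    by (rule instance_of_program)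
  have e: "rec_eval e [n, c] (if has_commuting_pair_on M Q then 1 else 0)" for n
  proof -
    have "rec_eval (Comp h [Proj 1]) [n, c] (instance_code c)"
      by (rule rec_eval.Comp[where ys = "[c]"]) (use h rec_eval.Proj[of 1 "[n, c]"] in auto)
    then show ?thesis unfolding e_def
      by (intro rec_eval.Comp[where ys = "[instance_code c]"]) (use d[OF c(1)] c(2) in auto)
  qed
  have "has_commuting_pair_on M Q \<longleftrightarrow> (\<exists>s'. run P (input_store c) End s')"
    using c(3,4) commuting_pair_run run_commuting_pair by blast
  also have "\<dots> \<longleftrightarrow> (\<exists>y. rec_eval (Mu e) [c] y)"
    unfolding P_def by (rule run_compile_iff)
  also have "\<dots> \<longleftrightarrow> \<not> has_commuting_pair_on M Q"
  proof
    assume "\<exists>y. rec_eval (Mu e) [c] y"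
    then obtain y where "rec_eval e [y, c] 0" by (auto elim: rec_eval_elims(7))
    from rec_eval_deterministic[OF e[of y] this] show "\<not> has_commuting_pair_on M Q"
      by (simp split: if_splits)
  next
    assume "\<not> has_commuting_pair_on M Q"
    then have "rec_eval (Mu e) [c] 0" using e[of 0] by (intro rec_eval.Mu) auto
    then show "\<exists>y. rec_eval (Mu e) [c] y" ..
  qed
  finally show False by blast
qed

end
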